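(* Let $\alpha_0,\alpha_1,\alpha_2,\beta_0,\beta_1,\gamma_0,\gamma_1\in\mathbb{C}$ with $\gamma_1\neq0$ and $\alpha_2\neq0$ be such that $$f(x_1,x_2)=\left(\alpha_0+\alpha_1x_1+\alpha_2x_2,\ \frac{\beta_0+\beta_1x_1}{\gamma_0+\gamma_1x_1}\right)$$ is birational. Let $F$ be its extension to $\mathbb{P}^2(\mathbb{C})$, $d_n=\deg(F^n)$, and $\delta(F)$ its dynamical degree. (a) Assume $\alpha_1\neq0$. Then the dynamical degree of $F$ is $\delta(F)=\delta^*:=\frac{1+\sqrt5}{2}$ and $d_{n+2}=d_n+d_{n+1}$ for all $n\in\mathbb{N}$. (b) Assume $\alpha_1=0$. Then after an affine change of coordinates (and renaming the parameters) $f$ takes the form $$f(x_1,x_2)=\left(x_2,\ \frac{\beta_0}{\gamma_0+x_1}\right)$$ and the dynamical degree of $F$ is $\delta(F)=1$. Furthermore, with $h(z):=\frac{\beta_0}{\gamma_0+z}$: ($b_1$) If $h$ is not a periodic map, then $d_n=2$ for all $n\in\mathbb{N}$. ($b_2$) If $h$ is a $k$-periodic map, then $d_n$ is a $2k$-periodic sequence.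
   Context: A map $f:\mathbb{C}^2\to\mathbb{C}^2$ with rational components is birational if there exist an algebraic curve $V$ and a rational map $g$ with $f\circ g=g\circ f=\mathrm{id}$ on $\mathbb{C}^2\setminus V$. Via the embedding $(x_1,x_2)\mapsto[1:x_1:x_2]$, $f$ induces a map $F:\mathbb{P}^2(\mathbb{C})\to\mathbb{P}^2(\mathbb{C})$ with homogeneous polynomial components; $d_n=\deg(F^n)$ is the common degree of the components of the iterate $F^n=F\circ\cdots\circ F$ after removing common factors ($n\ge1$). The dynamical degree is $\delta(F)=\lim_{n\to\infty}(\deg(F^n))^{1/n}$. A one-dimensional Möbius map $h$ is $k$-periodic if $h^k=\mathrm{id}$ ($h^k$ the $k$-th iterate) with $k\ge1$ minimal; it is periodic if it is $k$-periodic for some $k$. *)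

theory Defs
  imports
    "HOL-Computational_Algebra.Computational_Algebra"
    "HOL-Computational_Algebra.Field_as_Ring"
begin

text \<open>
  The ring \<open>\<complex>[x\<^sub>1, x\<^sub>2]\<close> is \<open>complex poly poly\<close>: the inner variable is \<open>x\<^sub>1\<close>, the outer one \<open>x\<^sub>2\<close>.
  The ring \<open>\<complex>[x\<^sub>0, x\<^sub>1, x\<^sub>2]\<close> is \<open>complex poly poly poly\<close>: from the innermost to the outermost level
  the variables are \<open>x\<^sub>0\<close>, \<open>x\<^sub>1\<close>, \<open>x\<^sub>2\<close>. Both are factorial rings with the library's \<open>gcd\<close>.
\<close>

type_synonym poly2 = "complex poly poly"
type_synonym poly3 = "complex poly poly poly"


subsection \<open>Rational self-maps of the affine plane\<close>

type_synonym rat_map = "poly2 fract \<times> poly2 fract"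

definition const2 :: "complex \<Rightarrow> poly2 fract"
  where "const2 c = to_fract [:[:c:]:]"

definition x1 :: "poly2 fract"
  where "x1 = to_fract [:[:0, 1:]:]"

definition x2 :: "poly2 fract"
  where "x2 = to_fract [:0, 1:]"

definition eval2 :: "poly2 \<Rightarrow> complex \<times> complex \<Rightarrow> complex"
  where "eval2 p x = poly (poly p [:snd x:]) (fst x)"

definition tdeg2 :: "poly2 \<Rightarrow> nat"
  where "tdeg2 p = Max (insert 0 {i + j | i j. coeff (coeff p j) i \<noteq> 0})"

text \<open>\<open>quot_of_fract\<close> yields the fraction in lowest terms, so \<open>rat_dom f\<close> is the full set of points
  at which both components are regular.\<close>

definition numer :: "poly2 fract \<Rightarrow> poly2"
  where "numer r = fst (quot_of_fract r)"

definition denom :: "poly2 fract \<Rightarrow> poly2"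
  where "denom r = snd (quot_of_fract r)"

definition rat_dom :: "rat_map \<Rightarrow> (complex \<times> complex) set"
  where "rat_dom f = {x. eval2 (denom (fst f)) x \<noteq> 0 \<and> eval2 (denom (snd f)) x \<noteq> 0}"

definition rat_app :: "rat_map \<Rightarrow> complex \<times> complex \<Rightarrow> complex \<times> complex"
  where "rat_app f x =
    (eval2 (numer (fst f)) x / eval2 (denom (fst f)) x,
     eval2 (numer (snd f)) x / eval2 (denom (snd f)) x)"

definition algebraic_curve :: "(complex \<times> complex) set \<Rightarrow> bool"
  where "algebraic_curve V \<longleftrightarrow> (\<exists>p. tdeg2 p > 0 \<and> V = {x. eval2 p x = 0})"

text \<open>The identities \<open>f \<circ> g = id\<close> and \<open>g \<circ> f = id\<close> off \<open>V\<close> include that both composites are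
  defined there; division by zero in \<open>rat_app\<close> therefore plays no role.\<close>

definition birational :: "rat_map \<Rightarrow> bool"
  where "birational f \<longleftrightarrow> (\<exists>V g. algebraic_curve V \<and>
    (\<forall>x. x \<notin> V \<longrightarrow> x \<in> rat_dom g \<and> rat_app g x \<in> rat_dom f \<and> rat_app f (rat_app g x) = x) \<and>
    (\<forall>x. x \<notin> V \<longrightarrow> x \<in> rat_dom f \<and> rat_app f x \<in> rat_dom g \<and> rat_app g (rat_app f x) = x))"

definition affine_auto :: "(complex \<times> complex \<Rightarrow> complex \<times> complex) \<Rightarrow> bool"
  where "affine_auto A \<longleftrightarrow> (\<exists>a b c d u v. a * d - b * c \<noteq> 0 \<and>
    A = (\<lambda>(x, y). (a * x + b * y + u, c * x + d * y + v)))"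

text \<open>\<open>affine_conj f g\<close>: in suitable affine coordinates \<open>f\<close> takes the form \<open>g\<close>,
  i.e. \<open>g = A \<circ> f \<circ> A\<^sup>-\<^sup>1\<close> as partial maps.\<close>

definition affine_conj :: "rat_map \<Rightarrow> rat_map \<Rightarrow> bool"
  where "affine_conj f g \<longleftrightarrow> (\<exists>A. affine_auto A \<and>
    (\<forall>x. A x \<in> rat_dom g \<longleftrightarrow> x \<in> rat_dom f) \<and>
    (\<forall>x \<in> rat_dom f. rat_app g (A x) = A (rat_app f x)))"


subsection \<open>Extension to the projective plane, degrees of the iterates\<close>

text \<open>A triple \<open>(P\<^sub>0, P\<^sub>1, P\<^sub>2)\<close> of forms of equal degree stands for \<open>x \<mapsto> [P\<^sub>0 x : P\<^sub>1 x : P\<^sub>2 x]\<close>.\<close>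

type_synonym proj_map = "poly3 \<times> poly3 \<times> poly3"

definition const3 :: "complex \<Rightarrow> poly3"
  where "const3 c = [:[:[:c:]:]:]"

definition X0 :: poly3 where "X0 = [:[:[:0, 1:]:]:]"
definition X1 :: poly3 where "X1 = [:[:0, 1:]:]"
definition X2 :: poly3 where "X2 = [:0, 1:]"

definition tdeg3 :: "poly3 \<Rightarrow> nat"
  where "tdeg3 P =
    Max (insert 0 {i + j + k | i j k. coeff (coeff (coeff P k) j) i \<noteq> 0})"

text \<open>\<open>x\<^sub>0\<^sup>D p(x\<^sub>1/x\<^sub>0, x\<^sub>2/x\<^sub>0)\<close>, for \<open>D \<ge> tdeg2 p\<close>.\<close>

definition homogenize :: "nat \<Rightarrow> poly2 \<Rightarrow> poly3"
  where "homogenize D p =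
    (\<Sum>j\<le>degree p. \<Sum>i\<le>degree (coeff p j).
       const3 (coeff (coeff p j) i) * X0 ^ (D - (i + j)) * X1 ^ i * X2 ^ j)"

text \<open>Clear denominators in \<open>[1 : p\<^sub>1/q\<^sub>1 : p\<^sub>2/q\<^sub>2]\<close> and homogenize.\<close>

definition extension :: "rat_map \<Rightarrow> proj_map"
  where "extension f =
    (let p1 = numer (fst f); q1 = denom (fst f); p2 = numer (snd f); q2 = denom (snd f);
         Q0 = lcm q1 q2; Q1 = p1 * (Q0 div q1); Q2 = p2 * (Q0 div q2);
         D = max (tdeg2 Q0) (max (tdeg2 Q1) (tdeg2 Q2))
     in (homogenize D Q0, homogenize D Q1, homogenize D Q2))"

definition subst3 :: "proj_map \<Rightarrow> poly3 \<Rightarrow> poly3"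
  where "subst3 G P = (case G of (G0, G1, G2) \<Rightarrow>
    poly (map_poly (\<lambda>q. poly (map_poly (\<lambda>r. poly (map_poly const3 r) G0) q) G1) P) G2)"

definition proj_comp :: "proj_map \<Rightarrow> proj_map \<Rightarrow> proj_map"
  where "proj_comp F G = (case F of (F0, F1, F2) \<Rightarrow> (subst3 G F0, subst3 G F1, subst3 G F2))"

definition proj_iter :: "proj_map \<Rightarrow> nat \<Rightarrow> proj_map"
  where "proj_iter F n = (proj_comp F ^^ n) (X0, X1, X2)"

text \<open>The common degree of the components after removing common factors (the maximum matters
  only if a component vanishes identically).\<close>

definition proj_degree :: "proj_map \<Rightarrow> nat"
  where "proj_degree F = (case F of (F0, F1, F2) \<Rightarrow>
    let h = gcd F0 (gcd F1 F2)
    in max (tdeg3 (F0 div h)) (max (tdeg3 (F1 div h)) (tdeg3 (F2 div h))))"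

definition iter_degree :: "proj_map \<Rightarrow> nat \<Rightarrow> nat"
  where "iter_degree F n = proj_degree (proj_iter F n)"

definition has_dynamical_degree :: "proj_map \<Rightarrow> real \<Rightarrow> bool"
  where "has_dynamical_degree F \<delta> \<longleftrightarrow> (\<lambda>n. root n (real (iter_degree F n))) \<longlonglongrightarrow> \<delta>"


subsection \<open>Periodicity\<close>

text \<open>The map \<open>z \<mapsto> (a z + b) / (c z + d)\<close> on the Riemann sphere \<open>\<complex> \<union> {\<infinity>}\<close>, where \<open>None\<close> is \<open>\<infinity>\<close>.\<close>

definition moebius_map ::
  "complex \<Rightarrow> complex \<Rightarrow> complex \<Rightarrow> complex \<Rightarrow> complex option \<Rightarrow> complex option"
  where "moebius_map a b c d w = (case w of
      None \<Rightarrow> if c = 0 then None else Some (a / c)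
    | Some z \<Rightarrow> if c * z + d = 0 then None else Some ((a * z + b) / (c * z + d)))"

definition periodic_map :: "nat \<Rightarrow> ('a \<Rightarrow> 'a) \<Rightarrow> bool"
  where "periodic_map k h \<longleftrightarrow> k \<ge> 1 \<and> h ^^ k = id \<and> (\<forall>j. 1 \<le> j \<and> j < k \<longrightarrow> h ^^ j \<noteq> id)"

text \<open>Sequences are indexed by \<open>n \<ge> 1\<close>; as for maps, the period is the minimal one.\<close>

definition periodic_seq :: "nat \<Rightarrow> (nat \<Rightarrow> 'a) \<Rightarrow> bool"
  where "periodic_seq p s \<longleftrightarrow> p \<ge> 1 \<and> (\<forall>n\<ge>1. s (n + p) = s n) \<and>
    (\<forall>q. 1 \<le> q \<and> q < p \<longrightarrow> \<not> (\<forall>n\<ge>1. s (n + q) = s n))"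

end

theory Submission
  imports Defs "HOL-Number_Theory.Fib"
begin

text \<open>
  Put \<open>h(z) = (b0 + b1 z) / (g + z)\<close>, the second component with its denominator made monic.
  Along an orbit of \<open>f\<close> the first coordinates satisfy \<open>x\<^sub>n\<^sub>+\<^sub>2 = \<alpha>0 + \<alpha>1 x\<^sub>n\<^sub>+\<^sub>1 + \<alpha>2 h(x\<^sub>n)\<close>, and
  since \<open>\<alpha>2 \<noteq> 0\<close> the pair \<open>(x\<^sub>n, x\<^sub>n\<^sub>+\<^sub>1)\<close> is an affine coordinate system. So up to a linear
  change of the target the \<open>n\<close>-th iterate is \<open>[1 : x\<^sub>n : x\<^sub>n\<^sub>+\<^sub>1]\<close>. If \<open>x\<^sub>n = P\<^sub>n / Q\<^sub>n\<close> in lowest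
  terms, with \<open>P\<^sub>n\<close> and \<open>Q\<^sub>n\<close> forms in the homogeneous coordinates \<open>X0, X1, X2\<close> of the same
  degree, then the degree of the iterate is the degree of the least common denominator of \<open>x\<^sub>n\<close>
  and \<open>x\<^sub>n\<^sub>+\<^sub>1\<close>, that is of \<open>lcm(Q\<^sub>n, Q\<^sub>n\<^sub>+\<^sub>1)\<close> (\<open>iter_degree_fraction_orbit\<close>). Both parts amount to
  computing these denominators. Birationality gives \<open>b0 \<noteq> g b1\<close>
  (\<open>birational_imp_nondegenerate\<close>), so \<open>h\<close> is an invertible Moebius map.

  If \<open>\<alpha>1 \<noteq> 0\<close>, a pole of \<open>x\<^sub>n\<close> stays a pole of all later terms, and each step adds the new
  poles on the curve \<open>x\<^sub>n = -g\<close>: \<open>Q\<^sub>n\<^sub>+\<^sub>2 = Q\<^sub>n\<^sub>+\<^sub>1 (g Q\<^sub>n + P\<^sub>n)\<close>. The degrees of these denominators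
  are Fibonacci numbers. What has to be shown is that no cancellation ever happens
  (\<open>coupled_coprime\<close>). The critical case is a component \<open>r = 0\<close> of \<open>x\<^sub>n = -g\<close> on which \<open>x\<^sub>n\<^sub>+\<^sub>1 =
  -g\<close> as well. As \<open>h\<close> is invertible, the recurrence can be run backwards, so that all earlier
  terms would be constant on that curve, down to \<open>x\<^sub>0\<close> and \<open>x\<^sub>1\<close>, which are independent
  coordinates (\<open>not_both_constant_mod_prime\<close>).

  If \<open>\<alpha>1 = 0\<close>, the recurrence decouples: \<open>x\<^sub>2\<^sub>m = \<phi>\<^sup>m(x\<^sub>0)\<close> and \<open>x\<^sub>2\<^sub>m\<^sub>+\<^sub>1 = \<phi>\<^sup>m(x\<^sub>1)\<close> for the Moebius
  map \<open>\<phi> = \<alpha>0 + \<alpha>2 h\<close>. All \<open>Q\<^sub>n\<close> are linear, and two consecutive ones have a common factor only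
  if both are multiples of \<open>X0\<close>, which happens only for \<open>n = 2m\<close> with \<open>\<phi>\<^sup>m\<close> affine. By
  Cayley-Hamilton the \<open>m\<close>-th power of a matrix \<open>N\<close> of trace \<open>t\<close> and determinant \<open>D\<close> is \<open>U\<^sub>m N\<close>
  plus a multiple of the identity, where \<open>U\<close> is the Lucas sequence of \<open>(t, D)\<close>. As \<open>\<phi>\<close> is not
  affine, \<open>\<phi>\<^sup>m\<close> is affine iff \<open>U\<^sub>m = 0\<close> iff \<open>\<phi>\<^sup>m = id\<close>. Thus \<open>d\<^sub>n = 1\<close> if \<open>n = 2m\<close> and \<open>U\<^sub>m = 0\<close>,
  and \<open>d\<^sub>n = 2\<close> otherwise. An affine conjugacy of \<open>f\<close> with \<open>(x2, b / (c + x1))\<close> multiplies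
  trace and determinant by \<open>s\<close> and \<open>s\<^sup>2\<close> (\<open>affine_conj_normal_form_unique\<close>), hence does not
  move the zeros of the Lucas sequence, and the zeros are exactly the \<open>m\<close> for which the \<open>m\<close>-th
  iterate of \<open>b / (c + z)\<close> is the identity.
\<close>

section \<open>Rational maps of the plane with an affine and a Moebius component\<close>

lemma numer_denom_Fract:
  assumes "coprime p q" "unit_factor q = 1"
  shows "numer (Fract p q) = p" "denom (Fract p q) = q"
proof -
  have "(p, q) \<in> normalized_fracts"
    using assms by (simp add: normalized_fracts_def)
  moreover have "quot_to_fract (p, q) = Fract p q"
    by (simp add: quot_to_fract_def)
  ultimately have "quot_of_fract (Fract p q) = (p, q)"
    using quot_of_fract_quot_to_fract'[of "(p, q)"] by simp
  then show "numer (Fract p q) = p" "denom (Fract p q) = q"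
    by (simp_all add: numer_def denom_def)
qed

lemma numer_denom_to_fract:
  "numer (to_fract p) = p" "denom (to_fract p) = 1"
  using numer_denom_Fract[of p 1] by (simp_all add: to_fract_def)

text \<open>The denominator is kept monic because \<open>numer\<close> and \<open>denom\<close> refer to the lowest terms with
  normalized denominator; with this form they can be read off.\<close>

definition moeb_x1 :: "complex \<Rightarrow> complex \<Rightarrow> complex \<Rightarrow> poly2 fract"
  where "moeb_x1 b0 b1 g = Fract [:[:b0, b1:]:] [:[:g, 1:]:]"

text \<open>Numerator minus \<open>b1\<close> times denominator is the constant \<open>b0 - g b1\<close>, so the two are
  coprime.\<close>

lemma numer_denom_moeb_x1:
  assumes "b0 \<noteq> g * b1"
  shows "numer (moeb_x1 b0 b1 g) = [:[:b0, b1:]:]" "denom (moeb_x1 b0 b1 g) = [:[:g, 1:]:]"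
proof -
  have cop: "coprime [:[:b0, b1:]:] ([:[:g, 1:]:] :: poly2)"
  proof (rule coprimeI)
    fix r :: poly2
    assume "r dvd [:[:b0, b1:]:]" "r dvd [:[:g, 1:]:]"
    then have "r dvd [:[:b0, b1:]:] - [:[:b1:]:] * [:[:g, 1:]:]"
      by (intro dvd_diff dvd_mult)
    also have "[:[:b0, b1:]:] - [:[:b1:]:] * [:[:g, 1:]:] = [:[:b0 - g * b1:]:]"
      by (simp add: algebra_simps)
    finally have "r dvd [:[:b0 - g * b1:]:]" .
    moreover have "[:[:b0 - g * b1:]:] dvd (1 :: poly2)"
      using assms by (simp add: is_unit_const_poly_iff is_unit_pCons_iff)
    ultimately show "is_unit r" using dvd_trans by blast
  qed
  have "unit_factor ([:[:g, 1:]:] :: poly2) = 1"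
    by (simp add: unit_factor_poly_def one_pCons)
  from numer_denom_Fract[OF cop this]
  show "numer (moeb_x1 b0 b1 g) = [:[:b0, b1:]:]" "denom (moeb_x1 b0 b1 g) = [:[:g, 1:]:]"
    by (simp_all add: moeb_x1_def)
qed

lemma moeb_x1_degenerate: "moeb_x1 (g * b1) b1 g = to_fract [:[:b1:]:]"
  by (simp add: moeb_x1_def to_fract_def eq_fract mult.commute)

lemma affine_fract: "const2 \<alpha>0 + const2 \<alpha>1 * x1 + const2 \<alpha>2 * x2
    = to_fract [:[:\<alpha>0, \<alpha>1:], [:\<alpha>2:]:]"
proof -
  have "const2 \<alpha>0 + const2 \<alpha>1 * x1 + const2 \<alpha>2 * x2
     = to_fract ([:[:\<alpha>0:]:] + [:[:\<alpha>1:]:] * [:[:0, 1:]:] + [:[:\<alpha>2:]:] * [:0, 1:])"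
    unfolding const2_def x1_def x2_def by (simp only: to_fract_add to_fract_mult)
  also have "[:[:\<alpha>0:]:] + [:[:\<alpha>1:]:] * [:[:0, 1:]:] + [:[:\<alpha>2:]:] * [:0, 1:]
     = [:[:\<alpha>0, \<alpha>1:], [:\<alpha>2:]:]"
    by simp
  finally show ?thesis .
qed

lemma moebius_fract:
  assumes "\<gamma>1 \<noteq> 0"
  shows "(const2 \<beta>0 + const2 \<beta>1 * x1) / (const2 \<gamma>0 + const2 \<gamma>1 * x1)
     = moeb_x1 (\<beta>0 / \<gamma>1) (\<beta>1 / \<gamma>1) (\<gamma>0 / \<gamma>1)"
proof -
  have lin: "const2 a + const2 b * x1 = Fract [:[:a, b:]:] 1" for a b
    using affine_fract[of a b 0] by (simp add: const2_def to_fract_def Zero_fract_def[symmetric])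
  have ne: "[:[:\<gamma>0, \<gamma>1:]:] \<noteq> (0::poly2)" using assms by simp
  have "(const2 \<beta>0 + const2 \<beta>1 * x1) / (const2 \<gamma>0 + const2 \<gamma>1 * x1)
     = Fract [:[:\<beta>0, \<beta>1:]:] [:[:\<gamma>0, \<gamma>1:]:]"
    unfolding lin using ne by simp
  also have "\<dots> = moeb_x1 (\<beta>0 / \<gamma>1) (\<beta>1 / \<gamma>1) (\<gamma>0 / \<gamma>1)"
  proof -
    have "[:[:\<beta>0, \<beta>1:]:] * [:[:\<gamma>0 / \<gamma>1, 1:]:]
      = [:[:\<beta>0 / \<gamma>1, \<beta>1 / \<gamma>1:]:] * [:[:\<gamma>0, \<gamma>1:]:]"
      using assms by simp
    then show ?thesis
      unfolding moeb_x1_def using ne by (subst eq_fract) simp_all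
  qed
  finally show ?thesis .
qed

lemma eval2_affine [simp]: "eval2 [:[:a, b:], [:c:]:] x = a + b * fst x + c * snd x"
  by (simp add: eval2_def algebra_simps)

lemma eval2_x1 [simp]: "eval2 [:[:a, b:]:] x = a + b * fst x"
  by (simp add: eval2_def algebra_simps)

lemma eval2_1 [simp]: "eval2 1 x = 1"
  by (simp add: eval2_def)

lemma eval2_x2 [simp]: "eval2 [:0, 1:] x = snd x"
  by (simp add: eval2_def)

lemma rat_dom_affine_moeb:
  assumes "b0 \<noteq> g * b1"
  shows "x \<in> rat_dom (to_fract p, moeb_x1 b0 b1 g) \<longleftrightarrow> fst x \<noteq> - g"
  using assms
  by (auto simp: rat_dom_def numer_denom_to_fract numer_denom_moeb_x1 eq_neg_iff_add_eq_0 add.commute)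

lemma rat_app_affine_moeb:
  assumes "b0 \<noteq> g * b1"
  shows "rat_app (to_fract p, moeb_x1 b0 b1 g) x
    = (eval2 p x, (b0 + b1 * fst x) / (g + fst x))"
  using assms by (auto simp: rat_app_def numer_denom_to_fract numer_denom_moeb_x1)

text \<open>Off the line \<open>x2 = c\<close> infinitely many values of each coordinate remain, so the bound for
  the number of roots applies first to the inner and then to the outer variable.\<close>

lemma eval2_eq_0_imp_eq_0:
  assumes "\<And>x y. y \<noteq> c \<Longrightarrow> eval2 p (x, y) = 0"
  shows "p = 0"
proof (rule ccontr)
  assume "p \<noteq> 0"
  have "poly p [:y:] = 0" if "y \<noteq> c" for y
  proof (rule ccontr)
    assume "poly p [:y:] \<noteq> 0"
    then have "finite {x. poly (poly p [:y:]) x = 0}" by (rule poly_roots_finite)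
    moreover have "{x. poly (poly p [:y:]) x = 0} = UNIV"
      using assms[OF that] by (auto simp: eval2_def)
    ultimately show False by (simp add: infinite_UNIV_char_0)
  qed
  then have "(\<lambda>y. [:y:]) ` (UNIV - {c}) \<subseteq> {z. poly p z = 0}" by auto
  moreover have "finite {z. poly p z = 0}" using \<open>p \<noteq> 0\<close> by (rule poly_roots_finite)
  ultimately have "finite ((\<lambda>y. [:y:]) ` (UNIV - {c}))" by (rule finite_subset)
  moreover have "inj_on (\<lambda>y::complex. [:y:]) (UNIV - {c})" by (auto intro: inj_onI)
  ultimately have "finite (UNIV - {c} :: complex set)" by (simp add: finite_image_iff)
  then show False by (simp add: infinite_UNIV_char_0)
qed

text \<open>If \<open>b0 = g b1\<close>, the second component is the constant \<open>b1\<close>, so every point outside the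
  exceptional curve would lie on the line \<open>x2 = b1\<close>, and the equation of the curve would
  vanish off this line.\<close>

lemma birational_imp_nondegenerate:
  assumes "birational (r, moeb_x1 b0 b1 g)"
  shows "b0 \<noteq> g * b1"
proof
  assume eq: "b0 = g * b1"
  obtain V h p where p: "tdeg2 p > 0" "V = {x. eval2 p x = 0}"
    and fh: "\<And>x. x \<notin> V \<Longrightarrow> rat_app (r, moeb_x1 b0 b1 g) (h x) = x"
    using assms unfolding birational_def algebraic_curve_def by metis
  have "eval2 p (x, y) = 0" if "y \<noteq> b1" for x y
  proof (rule ccontr)
    assume "eval2 p (x, y) \<noteq> 0"
    with fh[of "(x, y)"] p(2) have "snd (rat_app (r, moeb_x1 b0 b1 g) (h (x, y))) = y" by simp
    moreover have "snd (rat_app (r, moeb_x1 b0 b1 g) z) = b1" for z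
      unfolding eq moeb_x1_degenerate
      by (simp add: rat_app_def numer_denom_to_fract) (simp add: eval2_def)
    ultimately show False using that by simp
  qed
  then have "p = 0" by (rule eval2_eq_0_imp_eq_0)
  with p(1) show False by (simp add: tdeg2_def)
qed

lemma finite_tdeg2_set: "finite {i + j | i j. coeff (coeff p j) i \<noteq> 0}"
proof (rule finite_subset)
  show "{i + j | i j. coeff (coeff p j) i \<noteq> 0}
    \<subseteq> (\<Union>j\<le>degree p. (\<lambda>i. i + j) ` {..degree (coeff p j)})"
  proof clarify
    fix i j assume "coeff (coeff p j) i \<noteq> 0"
    then have "i \<le> degree (coeff p j)" "j \<le> degree p" by (auto intro: le_degree)
    then show "i + j \<in> (\<Union>j\<le>degree p. (\<lambda>i. i + j) ` {..degree (coeff p j)})" by auto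
  qed
qed auto

lemma le_tdeg2: "coeff (coeff p j) i \<noteq> 0 \<Longrightarrow> i + j \<le> tdeg2 p"
  unfolding tdeg2_def by (rule Max_ge) (use finite_tdeg2_set[of p] in auto)

lemma tdeg2_le:
  assumes "\<And>i j. coeff (coeff p j) i \<noteq> 0 \<Longrightarrow> i + j \<le> N"
  shows "tdeg2 p \<le> N"
  unfolding tdeg2_def by (subst Max_le_iff) (use finite_tdeg2_set[of p] assms in auto)

lemma const3_0 [simp]: "const3 0 = 0" and const3_1 [simp]: "const3 1 = 1"
  by (simp_all add: const3_def one_pCons)

lemma const3_add: "const3 (a + b) = const3 a + const3 b"
  and const3_mult: "const3 (a * b) = const3 a * const3 b"
  and const3_diff: "const3 (a - b) = const3 a - const3 b"
  and const3_minus: "const3 (- a) = - const3 a"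
  by (simp_all add: const3_def)

text \<open>Summing over a fixed rectangle avoids case distinctions on which of the parameters
  vanish.\<close>

lemma homogenize_eq_sum:
  assumes "\<And>i j. coeff (coeff p j) i \<noteq> 0 \<Longrightarrow> i \<le> m \<and> j \<le> n"
  shows "homogenize D p =
    (\<Sum>j\<le>n. \<Sum>i\<le>m. const3 (coeff (coeff p j) i) * X0 ^ (D - (i + j)) * X1 ^ i * X2 ^ j)"
    (is "_ = (\<Sum>j\<le>n. \<Sum>i\<le>m. ?t j i)")
proof -
  have z: "?t j i = 0" if "coeff (coeff p j) i = 0" for i j
    using that by simp
  have out: "?t j i = 0"
    if "\<not> i \<le> degree (coeff p j) \<or> \<not> j \<le> degree p \<or> \<not> i \<le> m \<or> \<not> j \<le> n" for i j
    by (rule z, cases "coeff p j = 0")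
      (use assms[of j i] that le_degree[of "coeff p j" i] le_degree[of p j] in auto)
  have inner: "(\<Sum>i\<le>degree (coeff p j). ?t j i) = (\<Sum>i\<le>m. ?t j i)" for j
    by (rule sum.mono_neutral_cong) (auto simp del: mult_eq_0_iff intro!: out)
  have "homogenize D p = (\<Sum>j\<le>degree p. \<Sum>i\<le>m. ?t j i)"
    unfolding homogenize_def inner ..
  also have "\<dots> = (\<Sum>j\<le>n. \<Sum>i\<le>m. ?t j i)"
    by (rule sum.mono_neutral_cong)
      (auto simp del: mult_eq_0_iff intro!: sum.neutral out)
  finally show ?thesis .
qed

lemma extension_eq:
  assumes "b0 \<noteq> g * b1" "\<alpha>2 \<noteq> 0"
  shows "extension (to_fract [:[:\<alpha>0, \<alpha>1:], [:\<alpha>2:]:], moeb_x1 b0 b1 g) =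
    (X0 * (const3 g * X0 + X1),
     (const3 \<alpha>0 * X0 + const3 \<alpha>1 * X1 + const3 \<alpha>2 * X2) * (const3 g * X0 + X1),
     X0 * (const3 b0 * X0 + const3 b1 * X1))"
proof -
  define A where "A = [:[:\<alpha>0, \<alpha>1:], [:\<alpha>2:]:]"
  define L where "L = [:[:g, 1:]:]"
  define M where "M = [:[:b0, b1:]:]"
  have AL: "A * L = [:[:\<alpha>0 * g, \<alpha>0 + g * \<alpha>1, \<alpha>1:], [:\<alpha>2 * g, \<alpha>2:]:]"
    by (simp add: A_def L_def algebra_simps)
  have normL: "normalize L = L"
    by (rule unit_factor_1_imp_normalized) (simp add: L_def unit_factor_poly_def one_pCons)
  have L0: "L \<noteq> 0" by (simp add: L_def)
  have cL: "i + j \<le> 1 \<and> i \<le> 1 \<and> j \<le> 0" if "coeff (coeff L j) i \<noteq> 0" for i j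
    using that by (auto simp: L_def coeff_pCons split: nat.splits)
  have cM: "i + j \<le> 1 \<and> i \<le> 1 \<and> j \<le> 0" if "coeff (coeff M j) i \<noteq> 0" for i j
    using that by (auto simp: M_def coeff_pCons split: nat.splits)
  have cAL: "i + j \<le> 2 \<and> i \<le> 2 \<and> j \<le> 1" if "coeff (coeff (A * L) j) i \<noteq> 0" for i j
    using that unfolding AL by (auto simp: coeff_pCons split: nat.splits)
  have "tdeg2 L \<le> 1" "tdeg2 M \<le> 1" "tdeg2 (A * L) \<le> 2"
    using cL cM cAL by (auto intro!: tdeg2_le)
  moreover have "1 + 1 \<le> tdeg2 (A * L)"
    by (rule le_tdeg2) (simp add: AL assms)
  ultimately have D: "max (tdeg2 L) (max (tdeg2 (A * L)) (tdeg2 M)) = 2" by simp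
  have ext: "extension (to_fract A, moeb_x1 b0 b1 g)
    = (homogenize 2 L, homogenize 2 (A * L), homogenize 2 M)"
    using assms(1) D L0 normL
    by (simp add: extension_def numer_denom_to_fract numer_denom_moeb_x1
        flip: L_def M_def)
  have "homogenize 2 L = X0 * (const3 g * X0 + X1)"
    using cL by (subst homogenize_eq_sum[where m=1 and n=0])
      (auto simp: L_def power2_eq_square algebra_simps)
  moreover have "homogenize 2 M = X0 * (const3 b0 * X0 + const3 b1 * X1)"
    using cM by (subst homogenize_eq_sum[where m=1 and n=0])
      (auto simp: M_def power2_eq_square algebra_simps)
  moreover have "homogenize 2 (A * L) =
     (const3 \<alpha>0 * X0 + const3 \<alpha>1 * X1 + const3 \<alpha>2 * X2) * (const3 g * X0 + X1)"
    using cAL by (subst homogenize_eq_sum[where m=2 and n=1])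
      (auto simp: AL power2_eq_square numeral_2_eq_2 const3_add const3_mult algebra_simps)
  ultimately show ?thesis using ext by (simp add: A_def)
qed

section \<open>Forms in three variables and the degree of a projective map\<close>

text \<open>The zero polynomial is a form of every degree, so sums and differences need no side
  condition.\<close>

definition form :: "nat \<Rightarrow> poly3 \<Rightarrow> bool"
  where "form e P \<longleftrightarrow> (\<forall>i j k. coeff (coeff (coeff P k) j) i \<noteq> 0 \<longrightarrow> i + j + k = e)"

lemma form_const3: "form 0 (const3 c)"
  by (auto simp: form_def const3_def coeff_pCons split: nat.splits)

lemma form_X: "form 1 X0" "form 1 X1" "form 1 X2"
  by (auto simp: form_def X0_def X1_def X2_def coeff_pCons coeff_1 one_pCons split: nat.splits)

lemma form_add: "form e P \<Longrightarrow> form e Q \<Longrightarrow> form e (P + Q)"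
  unfolding form_def by (metis add.right_neutral coeff_add)

lemma form_mult:
  assumes "form d P" "form e Q"
  shows "form (d + e) (P * Q)"
  unfolding form_def
proof (intro allI impI)
  fix i j k
  assume "coeff (coeff (coeff (P * Q) k) j) i \<noteq> 0"
  then have "(\<Sum>k'\<le>k. \<Sum>j'\<le>j. \<Sum>i'\<le>i. coeff (coeff (coeff P k') j') i' *
      coeff (coeff (coeff Q (k - k')) (j - j')) (i - i')) \<noteq> 0"
    by (simp add: coeff_mult coeff_sum)
  then obtain k' where k': "k' \<le> k" and "(\<Sum>j'\<le>j. \<Sum>i'\<le>i. coeff (coeff (coeff P k') j') i' *
      coeff (coeff (coeff Q (k - k')) (j - j')) (i - i')) \<noteq> 0"
    by (auto elim: sum.not_neutral_contains_not_neutral)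
  then obtain j' where j': "j' \<le> j" and "(\<Sum>i'\<le>i. coeff (coeff (coeff P k') j') i' *
      coeff (coeff (coeff Q (k - k')) (j - j')) (i - i')) \<noteq> 0"
    by (auto elim: sum.not_neutral_contains_not_neutral)
  then obtain i' where i': "i' \<le> i" and "coeff (coeff (coeff P k') j') i' *
      coeff (coeff (coeff Q (k - k')) (j - j')) (i - i') \<noteq> 0"
    by (auto elim: sum.not_neutral_contains_not_neutral)
  then have "coeff (coeff (coeff P k') j') i' \<noteq> 0"
      "coeff (coeff (coeff Q (k - k')) (j - j')) (i - i') \<noteq> 0"
    by auto
  then have "i' + j' + k' = d" "(i - i') + (j - j') + (k - k') = e"
    using assms unfolding form_def by blast+
  with i' j' k' show "i + j + k = d + e" by linarith
qed

lemma form_const3_mult: "form e P \<Longrightarrow> form e (const3 c * P)"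
  using form_mult[OF form_const3] by simp

lemma form_diff: "form e P \<Longrightarrow> form e Q \<Longrightarrow> form e (P - Q)"
  using form_add[of e P "- Q"] form_const3_mult[of e Q "- 1"] by (simp add: const3_minus)

lemmas form_intros = form_add form_diff form_const3_mult

lemma tdeg3_form:
  assumes "form e P" "P \<noteq> 0"
  shows "tdeg3 P = e"
proof -
  obtain i j k where "coeff (coeff (coeff P k) j) i \<noteq> 0"
    using assms(2) by (metis leading_coeff_0_iff)
  with assms(1) have "{i + j + k | i j k. coeff (coeff (coeff P k) j) i \<noteq> 0} = {e}"
    unfolding form_def by blast
  then show ?thesis unfolding tdeg3_def by simp
qed

lemma unit_factor_poly3: obtains c where "unit_factor (t :: poly3) = const3 c"
  by (simp add: unit_factor_poly_def const3_def)

text \<open>Dividing by the normalized gcd does not remove \<open>t\<close> exactly but leaves its unit factor,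
  which is a nonzero constant and does not affect the degree.\<close>

lemma proj_degree_common_factor:
  assumes gcd1: "gcd A (gcd B C) = 1" and "t \<noteq> 0"
    and forms: "form e A" "form e B" "form e C" and "A \<noteq> 0"
  shows "proj_degree (t * A, t * B, t * C) = e"
proof -
  obtain c where c: "unit_factor t = const3 c" by (rule unit_factor_poly3)
  have "c \<noteq> 0" using c \<open>t \<noteq> 0\<close> by auto
  have "gcd (t * A) (gcd (t * B) (t * C)) = normalize t"
    using gcd1 by (simp add: gcd_mult_left)
  moreover have "t * P div normalize t = const3 c * P" for P
  proof -
    have "t * P = normalize t * (const3 c * P)"
      by (metis c mult.assoc mult.commute unit_factor_mult_normalize)
    then show ?thesis using \<open>t \<noteq> 0\<close> by (metis nonzero_mult_div_cancel_left normalize_eq_0_iff)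
  qed
  moreover have "tdeg3 (const3 c * P) \<le> e" if "form e P" for P
    using tdeg3_form[OF form_const3_mult[OF that, of c]]
    by (cases "const3 c * P = 0") (auto simp: tdeg3_def)
  moreover have "tdeg3 (const3 c * A) = e"
    using forms(1) \<open>A \<noteq> 0\<close> \<open>c \<noteq> 0\<close>
    by (intro tdeg3_form form_const3_mult) (auto simp: const3_def)
  ultimately show ?thesis
    using forms by (simp add: proj_degree_def Let_def max_absorb1)
qed

lemma gcd3_eq_1I:
  fixes a b c :: poly3
  assumes "a \<noteq> 0" "\<And>r. prime r \<Longrightarrow> r dvd a \<Longrightarrow> r dvd b \<Longrightarrow> r dvd c \<Longrightarrow> False"
  shows "gcd a (gcd b c) = 1"
proof (rule ccontr)
  assume "gcd a (gcd b c) \<noteq> 1"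
  then have "\<not> is_unit (gcd a (gcd b c))" by simp
  moreover have "gcd a (gcd b c) \<noteq> 0" using assms(1) by simp
  ultimately obtain r where "r dvd gcd a (gcd b c)" "prime r"
    using prime_divisor_exists by blast
  then show False using assms(2) by auto
qed

lemma coprime_primeI:
  fixes a b :: poly3
  assumes "a \<noteq> 0" "\<And>r. prime r \<Longrightarrow> r dvd a \<Longrightarrow> r dvd b \<Longrightarrow> False"
  shows "coprime a b"
proof -
  have "gcd a (gcd b b) = 1" by (rule gcd3_eq_1I) (use assms in auto)
  then show ?thesis by (simp add: coprime_iff_gcd_eq_1)
qed

lemma prime_not_dvd_coprime:
  fixes a b r :: poly3
  assumes "coprime a b" "prime r" "r dvd a" "r dvd b"
  shows False
  using assms by (meson coprime_common_divisor not_prime_unit)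

lemma const3_eq_0_iff [simp]: "const3 c = 0 \<longleftrightarrow> c = 0"
  by (simp add: const3_def)

lemma dvd_const3_mult_iff:
  assumes "c \<noteq> 0"
  shows "r dvd const3 c * P \<longleftrightarrow> r dvd P"
proof -
  have "is_unit (const3 c)"
    using assms by (simp add: const3_def is_unit_pCons_iff is_unit_const_poly_iff dvd_field_iff)
  then show ?thesis by (simp add: dvd_mult_unit_iff')
qed

section \<open>Iterates in terms of the scalar recurrence\<close>

locale affine_moebius =
  fixes \<alpha>0 \<alpha>1 \<alpha>2 b0 b1 g :: complex
  assumes \<alpha>2: "\<alpha>2 \<noteq> 0" and nondeg: "b0 \<noteq> g * b1"
begin

definition plane_map :: rat_map
  where "plane_map = (to_fract [:[:\<alpha>0, \<alpha>1:], [:\<alpha>2:]:], moeb_x1 b0 b1 g)"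

definition F :: proj_map
  where "F = extension plane_map"

text \<open>\<open>W / X0\<close> is \<open>x\<^sub>1\<close>, the first coordinate after one step.\<close>

definition W :: poly3
  where "W = const3 \<alpha>0 * X0 + const3 \<alpha>1 * X1 + const3 \<alpha>2 * X2"

text \<open>For a fraction \<open>z = P / Q\<close>, \<open>h(z) = hnum P Q / hden P Q\<close>.\<close>

definition hden :: "poly3 \<Rightarrow> poly3 \<Rightarrow> poly3"
  where "hden P Q = const3 g * Q + P"

definition hnum :: "poly3 \<Rightarrow> poly3 \<Rightarrow> poly3"
  where "hnum P Q = const3 b0 * Q + const3 b1 * P"

text \<open>Written out as nested coefficient lists, the components of \<open>F\<close> can be substituted into
  by the simplifier.\<close>

lemma proj_comp_F:
  "proj_comp F (A, B, C) =
    (A * hden B A, (const3 \<alpha>0 * A + const3 \<alpha>1 * B + const3 \<alpha>2 * C) * hden B A, A * hnum B A)"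
proof -
  have F0: "X0 * (const3 g * X0 + X1) = [:[:[:0, 0, g:], [:0, 1:]:]:]"
    by (simp add: X0_def X1_def const3_def)
  have F1: "W * (const3 g * X0 + X1) =
      [:[:[:0, 0, \<alpha>0 * g:], [:0, \<alpha>0 + \<alpha>1 * g:], [:\<alpha>1:]:], [:[:0, \<alpha>2 * g:], [:\<alpha>2:]:]:]"
    by (simp add: X0_def X1_def X2_def const3_def W_def algebra_simps)
  have F2: "X0 * (const3 b0 * X0 + const3 b1 * X1) = [:[:[:0, 0, b0:], [:0, b1:]:]:]"
    by (simp add: X0_def X1_def const3_def)
  have s0: "subst3 (A, B, C) [:[:[:0, 0, g:], [:0, 1:]:]:] = A * hden B A"
    by (simp add: subst3_def map_poly_pCons hden_def algebra_simps)
  have s1: "subst3 (A, B, C)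
      [:[:[:0, 0, \<alpha>0 * g:], [:0, \<alpha>0 + \<alpha>1 * g:], [:\<alpha>1:]:], [:[:0, \<alpha>2 * g:], [:\<alpha>2:]:]:]
     = (const3 \<alpha>0 * A + const3 \<alpha>1 * B + const3 \<alpha>2 * C) * hden B A"
    by (simp add: subst3_def map_poly_pCons hden_def const3_add const3_mult algebra_simps)
  have s2: "subst3 (A, B, C) [:[:[:0, 0, b0:], [:0, b1:]:]:] = A * hnum B A"
    by (simp add: subst3_def map_poly_pCons hnum_def algebra_simps)
  show ?thesis
    unfolding F_def plane_map_def extension_eq[OF nondeg \<alpha>2] proj_comp_def W_def[symmetric]
    by (simp only: F0 F1 F2 s0 s1 s2 prod.case)
qed

lemma proj_iter_F_0: "proj_iter F 0 = (X0, X1, X2)"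
  by (simp add: proj_iter_def)

lemma proj_iter_F_Suc: "proj_iter F (Suc n) = proj_comp F (proj_iter F n)"
  by (simp add: proj_iter_def)

text \<open>The fractions \<open>P n / Q n\<close> solve the recurrence \<open>x\<^sub>n\<^sub>+\<^sub>2 = \<alpha>0 + \<alpha>1 x\<^sub>n\<^sub>+\<^sub>1 + \<alpha>2 h(x\<^sub>n)\<close>, stated
  without denominators, with initial values \<open>X1 / X0\<close> and \<open>W / X0\<close>.\<close>

definition fraction_orbit :: "(nat \<Rightarrow> poly3) \<Rightarrow> (nat \<Rightarrow> poly3) \<Rightarrow> bool"
  where "fraction_orbit P Q \<longleftrightarrow>
    P 0 = X1 \<and> Q 0 = X0 \<and> P (Suc 0) = W \<and> Q (Suc 0) = X0 \<and>
    (\<forall>n. Q n \<noteq> 0 \<and> hden (P n) (Q n) \<noteq> 0 \<and>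
      P (Suc (Suc n)) * (Q (Suc n) * hden (P n) (Q n)) =
      Q (Suc (Suc n)) * ((const3 \<alpha>0 * Q (Suc n) + const3 \<alpha>1 * P (Suc n)) * hden (P n) (Q n)
        + const3 \<alpha>2 * Q (Suc n) * hnum (P n) (Q n)))"

text \<open>The second affine coordinate after \<open>n\<close> steps is \<open>(x\<^sub>n\<^sub>+\<^sub>1 - \<alpha>0 - \<alpha>1 x\<^sub>n) / \<alpha>2\<close>; clearing
  denominators in \<open>[1 : x\<^sub>n : (x\<^sub>n\<^sub>+\<^sub>1 - \<alpha>0 - \<alpha>1 x\<^sub>n) / \<alpha>2]\<close> gives the triple on the right. The raw
  iterate is proportional to it, and the factors \<open>s\<close>, \<open>t\<close> record the proportionality.\<close>

lemma fraction_orbit_iterate: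
  assumes "fraction_orbit P Q"
  shows "\<exists>A B C s t. proj_iter F n = (A, B, C) \<and> s \<noteq> 0 \<and> t \<noteq> 0 \<and>
    s * A = t * (const3 \<alpha>2 * Q n * Q (Suc n)) \<and>
    s * B = t * (const3 \<alpha>2 * P n * Q (Suc n)) \<and>
    s * C = t * (P (Suc n) * Q n - const3 \<alpha>0 * Q n * Q (Suc n) - const3 \<alpha>1 * P n * Q (Suc n))"
proof (induction n)
  case 0
  have "P 0 = X1" "Q 0 = X0" "P (Suc 0) = W" "Q (Suc 0) = X0"
    using assms by (auto simp: fraction_orbit_def)
  \<comment> \<open>The common factor is \<open>\<alpha>2 X0\<close>, as \<open>Q 0 * Q 1\<close> is the square of \<open>X0\<close>.\<close>
  then show ?case
    by (intro exI[of _ X0] exI[of _ X1] exI[of _ X2] exI[of _ "const3 \<alpha>2 * X0"] exI[of _ 1])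
      (use \<alpha>2 in \<open>auto simp: proj_iter_F_0 W_def X0_def algebra_simps
        simp del: mult_pCons_left mult_pCons_right\<close>)
next
  case (Suc n)
  define a0 a1 a2 where a_def: "a0 = const3 \<alpha>0" "a1 = const3 \<alpha>1" "a2 = const3 \<alpha>2"
  define p q p' q' p'' q'' where pq: "p = P n" "q = Q n" "p' = P (Suc n)" "q' = Q (Suc n)"
    "p'' = P (Suc (Suc n))" "q'' = Q (Suc (Suc n))"
  define l where "l = hden p q"
  define m where "m = hnum p q"
  have nz: "q \<noteq> 0" "q' \<noteq> 0" "q'' \<noteq> 0" "l \<noteq> 0"
    and rec: "p'' * (q' * l) = q'' * ((a0 * q' + a1 * p') * l + a2 * q' * m)"
    using assms unfolding fraction_orbit_def pq l_def m_def a_def by blast+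
  have a2: "a2 \<noteq> 0" using \<alpha>2 by (simp add: a_def)
  obtain A B C s t where it: "proj_iter F n = (A, B, C)" and st: "s \<noteq> 0" "t \<noteq> 0"
    and A: "s * A = t * (a2 * q * q')"
    and B: "s * B = t * (a2 * p * q')"
    and C: "s * C = t * (p' * q - a0 * q * q' - a1 * p * q')"
    using Suc.IH unfolding pq a_def by blast
  have hd: "s * hden B A = t * a2 * q' * l"
  proof -
    have "s * hden B A = const3 g * (s * A) + s * B" by (simp add: hden_def algebra_simps)
    also have "\<dots> = t * a2 * q' * l" unfolding A B by (simp add: l_def hden_def algebra_simps)
    finally show ?thesis .
  qed
  have hn: "s * hnum B A = t * a2 * q' * m"
  proof -
    have "s * hnum B A = const3 b0 * (s * A) + const3 b1 * (s * B)"
      by (simp add: hnum_def algebra_simps)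
    also have "\<dots> = t * a2 * q' * m" unfolding A B by (simp add: m_def hnum_def algebra_simps)
    finally show ?thesis .
  qed
  have aff: "s * (a0 * A + a1 * B + a2 * C) = t * (a2 * q * p')"
  proof -
    have "s * (a0 * A + a1 * B + a2 * C) = a0 * (s * A) + a1 * (s * B) + a2 * (s * C)"
      by (simp add: algebra_simps)
    also have "\<dots> = t * (a2 * q * p')" unfolding A B C by (simp add: algebra_simps)
    finally show ?thesis .
  qed
  define s' where "s' = s * s * q''"
  define t' where "t' = t * t * a2 * q * q' * l"
  show ?case
  proof (intro exI conjI)
    show "proj_iter F (Suc n) =
        (A * hden B A, (a0 * A + a1 * B + a2 * C) * hden B A, A * hnum B A)"
      by (simp add: proj_iter_F_Suc it proj_comp_F a_def)
    show "s' \<noteq> 0" "t' \<noteq> 0" using nz a2 st by (auto simp: s'_def t'_def)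
    have "s' * (A * hden B A) = q'' * ((s * A) * (s * hden B A))"
      by (simp add: s'_def algebra_simps)
    also have "\<dots> = t' * (a2 * q' * q'')"
      unfolding A hd by (simp add: t'_def algebra_simps)
    finally show "s' * (A * hden B A) = t' * (const3 \<alpha>2 * Q (Suc n) * Q (Suc (Suc n)))"
      by (simp add: pq a_def)
    have "s' * ((a0 * A + a1 * B + a2 * C) * hden B A)
      = q'' * ((s * (a0 * A + a1 * B + a2 * C)) * (s * hden B A))"
      by (simp add: s'_def algebra_simps)
    also have "\<dots> = t' * (a2 * p' * q'')"
      unfolding aff hd by (simp add: t'_def algebra_simps)
    finally show "s' * ((a0 * A + a1 * B + a2 * C) * hden B A)
      = t' * (const3 \<alpha>2 * P (Suc n) * Q (Suc (Suc n)))"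
      by (simp add: pq a_def)
    have "s' * (A * hnum B A) = q'' * ((s * A) * (s * hnum B A))"
      by (simp add: s'_def algebra_simps)
    also have "\<dots> = t * t * a2 * q * q' * (q'' * (a2 * q' * m))"
      unfolding A hn by (simp add: algebra_simps)
    also have "q'' * (a2 * q' * m) = p'' * (q' * l) - q'' * ((a0 * q' + a1 * p') * l)"
      unfolding rec by (simp add: algebra_simps)
    also have "t * t * a2 * q * q' * (p'' * (q' * l) - q'' * ((a0 * q' + a1 * p') * l))
      = t' * (p'' * q' - a0 * q' * q'' - a1 * p' * q'')"
      by (simp add: t'_def algebra_simps)
    finally show "s' * (A * hnum B A) = t' * (P (Suc (Suc n)) * Q (Suc n)
        - const3 \<alpha>0 * Q (Suc n) * Q (Suc (Suc n)) - const3 \<alpha>1 * P (Suc n) * Q (Suc (Suc n)))"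
      by (simp add: pq a_def)
  qed
qed

text \<open>\<open>G * q * q'\<close> is the least common denominator of \<open>x\<^sub>n\<close> and \<open>x\<^sub>n\<^sub>+\<^sub>1\<close>. A prime factor of it
  occurs in one of the two denominators to the full power, so it cannot divide the
  corresponding numerator after clearing denominators; hence the triple with this denominator
  is reduced.\<close>

lemma iter_degree_fraction_orbit:
  assumes orbit: "fraction_orbit P Q"
    and fac: "Q n = G * q" "Q (Suc n) = G * q'" "coprime q q'"
    and cop: "coprime (P n) (Q n)" "coprime (P (Suc n)) (Q (Suc n))"
    and forms: "form k G" "form i q" "form j q'" "form (k + i) (P n)" "form (k + j) (P (Suc n))"
  shows "iter_degree F n = k + i + j"
proof -
  obtain A B C s t where it: "proj_iter F n = (A, B, C)" and st: "s \<noteq> 0" "t \<noteq> 0"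
    and ABC: "s * A = t * (const3 \<alpha>2 * Q n * Q (Suc n))"
      "s * B = t * (const3 \<alpha>2 * P n * Q (Suc n))"
      "s * C = t * (P (Suc n) * Q n - const3 \<alpha>0 * Q n * Q (Suc n) - const3 \<alpha>1 * P n * Q (Suc n))"
    using fraction_orbit_iterate[OF orbit] by blast
  have nz: "G \<noteq> 0" "q \<noteq> 0" "q' \<noteq> 0"
    using orbit fac(1,2) unfolding fraction_orbit_def by (metis mult_zero_left mult_zero_right)+
  define A' where "A' = const3 \<alpha>2 * (G * (q * q'))"
  define B' where "B' = const3 \<alpha>2 * (P n * q')"
  define C' where "C' = P (Suc n) * q - const3 \<alpha>0 * (G * (q * q')) - const3 \<alpha>1 * (P n * q')"
  have gcd1: "gcd A' (gcd B' C') = 1"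
  proof (rule gcd3_eq_1I)
    show "A' \<noteq> 0" using nz \<alpha>2 by (simp add: A'_def)
    fix r :: poly3
    assume r: "prime r" "r dvd A'" "r dvd B'" "r dvd C'"
    have 1: "r dvd G * (q * q')" and 2: "r dvd P n * q'"
      using r(2,3) by (simp_all add: A'_def B'_def dvd_const3_mult_iff[OF \<alpha>2])
    have "P (Suc n) * q = C' + const3 \<alpha>0 * (G * (q * q')) + const3 \<alpha>1 * (P n * q')"
      by (simp add: C'_def)
    then have 3: "r dvd P (Suc n) * q"
      using 1 2 r(4) by simp
    consider "r dvd G" | "r dvd q" | "r dvd q'"
      using 1 r(1) prime_dvd_mult_iff by blast
    then show False
    proof cases
      case 1
      then have "r dvd q'" "r dvd q"
        using 2 3 cop fac r(1) prime_not_dvd_coprime prime_dvd_mult_iff by (metis dvd_mult2)+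
      then show ?thesis using fac(3) r(1) prime_not_dvd_coprime by blast
    next
      case 2
      then have "r dvd q'"
        using \<open>r dvd P n * q'\<close> cop fac r(1) prime_not_dvd_coprime prime_dvd_mult_iff
        by (metis dvd_mult)
      then show ?thesis using 2 fac(3) r(1) prime_not_dvd_coprime by blast
    next
      case 3
      then have "r dvd q"
        using \<open>r dvd P (Suc n) * q\<close> cop fac r(1) prime_not_dvd_coprime prime_dvd_mult_iff
        by (metis dvd_mult)
      then show ?thesis using 3 fac(3) r(1) prime_not_dvd_coprime by blast
    qed
  qed
  have sA: "s * A = (t * G) * A'" and sB: "s * B = (t * G) * B'" and sC: "s * C = (t * G) * C'"
    unfolding ABC fac(1,2) A'_def B'_def C'_def by (simp_all add: algebra_simps)
  \<comment> \<open>The triple \<open>A', B', C'\<close> is reduced, so \<open>s\<close> can be cancelled against \<open>t * G\<close>.\<close>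
  have "s dvd gcd ((t * G) * A') (gcd ((t * G) * B') ((t * G) * C'))"
    unfolding sA[symmetric] sB[symmetric] sC[symmetric] by simp
  also have "\<dots> = normalize (t * G)" using gcd1 by (simp add: gcd_mult_left)
  finally obtain u where u: "t * G = s * u" by (auto elim: dvdE)
  have "u \<noteq> 0" using u st nz by auto
  have "A = u * A'" "B = u * B'" "C = u * C'"
    using sA sB sC st(1) unfolding u by (auto simp: mult.assoc)
  moreover have "form (k + i + j) A'" "form (k + i + j) B'" "form (k + i + j) C'"
  proof -
    have 1: "form (k + i + j) (G * (q * q'))"
      using form_mult[OF forms(1) form_mult[OF forms(2,3)]] by (simp add: add.assoc)
    have 2: "form (k + i + j) (P n * q')"
      using form_mult[OF forms(4,3)] by simp
    have 3: "form (k + i + j) (P (Suc n) * q)"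
      using form_mult[OF forms(5,2)] by (simp add: ac_simps)
    show "form (k + i + j) A'" "form (k + i + j) B'" "form (k + i + j) C'"
      unfolding A'_def B'_def C'_def using 1 2 3 by (auto intro: form_intros)
  qed
  ultimately show ?thesis
    using proj_degree_common_factor[OF gcd1 \<open>u \<noteq> 0\<close>] nz \<alpha>2
    by (simp add: iter_degree_def it A'_def)
qed

end

section \<open>Linear forms without common factor\<close>

text \<open>A divisor of a nonzero constant polynomial is constant, hence divides every coefficient
  of each of its multiples.\<close>

lemma dvd_const_poly_imp_unit:
  fixes q r :: "'a::idom poly"
  assumes "r dvd [:s:]" "s \<noteq> 0" "r dvd q" "coeff q i dvd 1"
  shows "r dvd 1"
proof -
  have "degree r = 0"
    using dvd_imp_degree_le[OF assms(1)] assms(2) by simp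
  then obtain c where c: "r = [:c:]" by (rule degree_eq_zeroE)
  then have "c dvd coeff q i" using assms(3) const_poly_dvd_iff by blast
  then have "c dvd 1" using assms(4) dvd_trans by blast
  then show ?thesis by (simp add: c is_unit_const_poly_iff)
qed

text \<open>The first form does not involve the outermost variable \<open>X2\<close>, and in the second one \<open>X2\<close>
  has a unit as coefficient.\<close>

lemma no_prime_dvd_linear_forms:
  assumes "prime r" "r dvd const3 a * X0 + const3 b * X1" "a \<noteq> 0 \<or> b \<noteq> 0"
    and "r dvd const3 a' * X0 + const3 b' * X1 + const3 c * X2" "c \<noteq> 0"
  shows False
proof -
  have "is_unit r"
  proof (rule dvd_const_poly_imp_unit)
    show "r dvd [:[:[:0, a:], [:b:]:]:]"
      using assms(2) by (simp add: const3_def X0_def X1_def)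
    show "r dvd [:[:[:0, a':], [:b':]:], [:[:c:]:]:]"
      using assms(4) by (simp add: const3_def X0_def X1_def X2_def)
    show "is_unit (coeff [:[:[:0, a':], [:b':]:], [:[:c:]:]:] 1)"
      using assms(5) by (simp add: is_unit_const_poly_iff dvd_field_iff)
  qed (use assms(3) in auto)
  with assms(1) show False using not_prime_unit by blast
qed

lemma no_prime_dvd_X0_X1:
  assumes "prime r" "r dvd X0" "r dvd X1"
  shows False
proof -
  have "degree r = 0"
    using dvd_imp_degree_le[OF assms(2)] by (simp add: X0_def)
  then obtain s where s: "r = [:s:]" by (rule degree_eq_zeroE)
  have "is_unit s"
  proof (rule dvd_const_poly_imp_unit)
    show "s dvd [:[:0, 1:]:]" "s dvd [:0, 1:]"
      using assms(2,3) by (simp_all add: s X0_def X1_def)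
    show "is_unit (coeff ([:0, 1:] :: poly2) 1)" by simp
  qed auto
  with assms(1) s show False by (simp add: is_unit_const_poly_iff prime_def prime_elem_def)
qed

lemma X0_not_unit: "\<not> is_unit X0"
  by (simp add: X0_def is_unit_const_poly_iff is_unit_pCons_iff)

lemma X_nonzero: "X0 \<noteq> 0" "X1 \<noteq> 0"
  by (simp_all add: X0_def X1_def)

context affine_moebius
begin

lemma form_W: "form 1 W"
  unfolding W_def by (intro form_intros form_X)

lemma coprime_X1_X0: "coprime X1 X0"
  using no_prime_dvd_X0_X1 X_nonzero by (intro coprime_primeI) auto

lemma coprime_W_X0: "coprime W X0"
proof -
  have "coprime X0 W"
  proof (rule coprime_primeI)
    fix r assume "prime r" "r dvd X0" "r dvd W"
    then show False
      using no_prime_dvd_linear_forms[of r 1 0 \<alpha>0 \<alpha>1 \<alpha>2] \<alpha>2 by (simp add: W_def)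
  qed (rule X_nonzero)
  then show ?thesis by (simp add: coprime_commute)
qed

text \<open>Because of \<open>b0 \<noteq> g b1\<close>, the fraction \<open>h(P / Q)\<close> is again in lowest terms.\<close>

lemma hden_hnum_coprime:
  assumes "coprime P Q" "prime r" "r dvd hden P Q" "r dvd hnum P Q"
  shows False
proof -
  have k: "b0 - g * b1 \<noteq> 0" using nondeg by simp
  have "hnum P Q - const3 b1 * hden P Q = const3 (b0 - g * b1) * Q"
    by (simp add: hnum_def hden_def const3_diff const3_mult algebra_simps)
  then have "r dvd const3 (b0 - g * b1) * Q"
    using assms(3,4) by (metis dvd_diff dvd_mult)
  then have Q: "r dvd Q" by (simp only: dvd_const3_mult_iff[OF k])
  then have "r dvd hden P Q - const3 g * Q"
    using assms(3) by (simp add: dvd_diff)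
  then have "r dvd P" by (simp add: hden_def)
  with Q assms(1,2) show False using prime_not_dvd_coprime by blast
qed

section \<open>The coupled case: Fibonacci degrees\<close>

text \<open>The recurrence on fractions when \<open>x\<^sub>n\<^sub>+\<^sub>1\<close> contributes its poles: the denominator of the
  right hand side is \<open>Q\<^sub>n\<^sub>+\<^sub>1\<close> times that of \<open>h(x\<^sub>n)\<close>.\<close>

fun coupled_num coupled_den :: "nat \<Rightarrow> poly3" where
  "coupled_num 0 = X1"
| "coupled_num (Suc 0) = W"
| "coupled_num (Suc (Suc n)) =
    (const3 \<alpha>0 * coupled_den (Suc n) + const3 \<alpha>1 * coupled_num (Suc n))
        * hden (coupled_num n) (coupled_den n)
      + const3 \<alpha>2 * coupled_den (Suc n) * hnum (coupled_num n) (coupled_den n)"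
| "coupled_den 0 = X0"
| "coupled_den (Suc 0) = X0"
| "coupled_den (Suc (Suc n)) = coupled_den (Suc n) * hden (coupled_num n) (coupled_den n)"

lemma coupled_den_dvd_Suc: "coupled_den n dvd coupled_den (Suc n)"
  by (cases n) auto

lemma X0_dvd_coupled_den: "X0 dvd coupled_den n"
  by (induction n) (use coupled_den_dvd_Suc dvd_trans in auto)

text \<open>Working modulo \<open>r\<close> means restricting to the curve \<open>r = 0\<close>, and as \<open>r\<close> does not divide
  \<open>Q\<^sub>n\<^sub>+\<^sub>1\<close>, none of the denominators vanishes there: \<open>x\<^sub>0, \<dots>, x\<^sub>n\<^sub>+\<^sub>1\<close> are finite. If \<open>x\<^sub>n\<close> and
  \<open>x\<^sub>n\<^sub>+\<^sub>1\<close> were constant on this curve, the recurrence would determine a constant value of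
  \<open>h(x\<^sub>n\<^sub>-\<^sub>1)\<close>, hence of \<open>x\<^sub>n\<^sub>-\<^sub>1\<close>. Descending, \<open>x\<^sub>0\<close> and \<open>x\<^sub>1\<close> would be constant, but a curve is not
  a point.\<close>

lemma not_both_constant_mod_prime:
  assumes "prime r" "\<not> r dvd coupled_den (Suc n)"
    and "r dvd coupled_num n - const3 c * coupled_den n"
    and "r dvd coupled_num (Suc n) - const3 c' * coupled_den (Suc n)"
  shows False
  using assms(2-)
proof (induction n arbitrary: c c')
  case 0
  show ?case
  proof (rule no_prime_dvd_linear_forms[OF assms(1)])
    show "r dvd const3 (- c) * X0 + const3 1 * X1"
      using 0(2) by (simp add: const3_minus)
    have "W - const3 c' * X0 =
        const3 (\<alpha>0 - c') * X0 + const3 \<alpha>1 * X1 + const3 \<alpha>2 * X2"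
      by (simp add: W_def const3_diff algebra_simps)
    then show "r dvd const3 (\<alpha>0 - c') * X0 + const3 \<alpha>1 * X1 + const3 \<alpha>2 * X2"
      using 0(3) by simp
  qed (use \<alpha>2 in auto)
next
  case (Suc n)
  define P Q P' Q' where PQ: "P = coupled_num n" "Q = coupled_den n"
    "P' = coupled_num (Suc n)" "Q' = coupled_den (Suc n)"
  define l m where lm: "l = hden P Q" "m = hnum P Q"
  have Q': "\<not> r dvd Q'" and l: "\<not> r dvd l"
    using Suc.prems(1) by (auto simp: PQ lm)
  \<comment> \<open>On the curve, \<open>h(x\<^sub>n)\<close> has the constant value \<open>- \<kappa> / \<alpha>2\<close>.\<close>
  define \<kappa> where "\<kappa> = \<alpha>0 - c' + \<alpha>1 * c"
  have "coupled_num (Suc (Suc n)) - const3 c' * coupled_den (Suc (Suc n)) =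
      Q' * (const3 \<kappa> * l + const3 \<alpha>2 * m) + const3 \<alpha>1 * l * (P' - const3 c * Q')"
    by (simp add: PQ lm \<kappa>_def const3_add const3_diff const3_mult algebra_simps)
  moreover have "r dvd const3 \<alpha>1 * l * (P' - const3 c * Q')"
    using Suc.prems(2) by (simp add: PQ)
  ultimately have "r dvd Q' * (const3 \<kappa> * l + const3 \<alpha>2 * m)"
    using Suc.prems(3) by (simp add: dvd_add_left_iff)
  then have d: "r dvd const3 \<kappa> * l + const3 \<alpha>2 * m"
    using Q' assms(1) prime_dvd_mult_iff by blast
  define u v where uv: "u = \<kappa> * g + \<alpha>2 * b0" "v = \<kappa> + \<alpha>2 * b1"
  have eq: "const3 \<kappa> * l + const3 \<alpha>2 * m = const3 u * Q + const3 v * P"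
    by (simp add: lm uv hden_def hnum_def const3_add const3_mult algebra_simps)
  show ?case
  proof (cases "v = 0")
    case True
    \<comment> \<open>The value is \<open>b1 = h(\<infinity>)\<close>, so \<open>x\<^sub>n\<close> would be infinite on the curve.\<close>
    have "u = \<alpha>2 * (b0 - g * b1) + g * v" by (simp add: uv algebra_simps)
    then have u: "u \<noteq> 0" using True \<alpha>2 nondeg by simp
    have "r dvd const3 u * Q" using d eq True by simp
    then have "r dvd Q" by (simp only: dvd_const3_mult_iff[OF u])
    then show False using Q' coupled_den_dvd_Suc[of n] dvd_trans PQ by blast
  next
    case False
    have "const3 u = const3 v * const3 (u / v)"
      using False by (simp flip: const3_mult)
    then have "const3 u * Q + const3 v * P = const3 v * (P - const3 (- u / v) * Q)"
      by (simp add: const3_minus algebra_simps)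
    then have "r dvd P - const3 (- u / v) * Q"
      using d eq dvd_const3_mult_iff[OF False] by metis
    then show False
      using Suc.IH[of "- u / v" c] Q' Suc.prems(2) by (simp add: PQ)
  qed
qed

text \<open>The last conjunct makes the induction work: without new poles on the old ones, the three
  summands of \<open>x\<^sub>n\<^sub>+\<^sub>2\<close> cannot cancel along a factor of the denominator. Along a factor of \<open>Q\<^sub>n\<^sub>+\<^sub>1\<close>
  the term \<open>\<alpha>1 x\<^sub>n\<^sub>+\<^sub>1\<close> dominates, which is where \<open>\<alpha>1 \<noteq> 0\<close> is used; along the other factors \<open>\<alpha>2
  h(x\<^sub>n)\<close> does.\<close>

lemma coupled_coprime:
  assumes "\<alpha>1 \<noteq> 0"
  shows "coupled_den n \<noteq> 0 \<and> coprime (coupled_den n) (coupled_num n)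
    \<and> coupled_den (Suc n) \<noteq> 0 \<and> coprime (coupled_den (Suc n)) (coupled_num (Suc n))
    \<and> hden (coupled_num n) (coupled_den n) \<noteq> 0
    \<and> coprime (coupled_den (Suc n)) (hden (coupled_num n) (coupled_den n))"
proof (induction n)
  case 0
  have "coprime X0 X1" "coprime X0 W"
    using coprime_X1_X0 coprime_W_X0 by (simp_all add: coprime_commute)
  moreover have "coprime X0 (hden X1 X0)"
  proof (rule coprime_primeI)
    fix r assume r: "prime r" "r dvd X0" "r dvd hden X1 X0"
    then have "r dvd X1" by (simp add: hden_def dvd_add_right_iff)
    with r show False using no_prime_dvd_X0_X1 by blast
  qed (rule X_nonzero)
  moreover have "hden X1 X0 \<noteq> 0"
    by (simp add: hden_def X0_def X1_def const3_def)
  ultimately show ?case by (simp add: X_nonzero)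
next
  case (Suc n)
  define P Q P' Q' where PQ: "P = coupled_num n" "Q = coupled_den n"
    "P' = coupled_num (Suc n)" "Q' = coupled_den (Suc n)"
  define l m where lm: "l = hden P Q" "m = hnum P Q"
  have IH: "Q' \<noteq> 0" "l \<noteq> 0" "coprime Q P" "coprime Q' P'" "coprime Q' l"
    using Suc.IH by (simp_all add: PQ lm)
  have Q'': "coupled_den (Suc (Suc n)) = Q' * l" and P'': "coupled_num (Suc (Suc n)) =
      (const3 \<alpha>0 * Q' + const3 \<alpha>1 * P') * l + const3 \<alpha>2 * Q' * m"
    by (simp_all add: PQ lm)
  have ne: "Q' * l \<noteq> 0" using IH by simp
  have c1: "coprime (Q' * l) (coupled_num (Suc (Suc n)))"
  proof (rule coprime_primeI[OF ne])
    fix r assume r: "prime r" "r dvd Q' * l" "r dvd coupled_num (Suc (Suc n))"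
    have "coupled_num (Suc (Suc n)) = const3 \<alpha>0 * (Q' * l)
        + (const3 \<alpha>1 * (P' * l) + const3 \<alpha>2 * (Q' * m))"
      unfolding P'' by (simp add: algebra_simps)
    then have s: "r dvd const3 \<alpha>1 * (P' * l) + const3 \<alpha>2 * (Q' * m)"
      using r(2,3) by (simp add: dvd_add_right_iff)
    show False
    proof (cases "r dvd Q'")
      case True
      then have "r dvd const3 \<alpha>1 * (P' * l)" using s by (simp add: dvd_add_left_iff)
      then have "r dvd P' * l" by (simp only: dvd_const3_mult_iff[OF assms])
      then show False
        using True IH r(1) prime_not_dvd_coprime prime_dvd_mult_iff by blast
    next
      case False
      then have l: "r dvd l" using r(1,2) prime_dvd_mult_iff by blast
      then have "r dvd const3 \<alpha>2 * (Q' * m)" using s by (simp add: dvd_add_right_iff)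
      then have "r dvd Q' * m" by (simp only: dvd_const3_mult_iff[OF \<alpha>2])
      then have "r dvd m" using False r(1) prime_dvd_mult_iff by blast
      with l r(1) IH(3) show False
        unfolding lm using hden_hnum_coprime[of P Q r] by (simp add: coprime_commute)
    qed
  qed
  have c2: "coprime (Q' * l) (hden P' Q')"
  proof (rule coprime_primeI[OF ne])
    fix r assume r: "prime r" "r dvd Q' * l" "r dvd hden P' Q'"
    have nQ: "\<not> r dvd Q'"
    proof
      assume "r dvd Q'"
      with r(3) have "r dvd P'" by (simp add: hden_def dvd_add_right_iff)
      with \<open>r dvd Q'\<close> r(1) IH(4) show False using prime_not_dvd_coprime by blast
    qed
    then have "r dvd l" using r(1,2) prime_dvd_mult_iff by blast
    then show False
      using not_both_constant_mod_prime[OF r(1), of n "- g" "- g"] nQ r(3)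
      by (simp add: PQ lm hden_def const3_minus add.commute)
  qed
  have "hden P' Q' \<noteq> 0"
  proof
    assume "hden P' Q' = 0"
    with c2 have "is_unit (coupled_den (Suc (Suc n)))" by (simp add: Q'' del: coupled_den.simps)
    then have "is_unit X0" using X0_dvd_coupled_den dvd_trans by blast
    with X0_not_unit show False ..
  qed
  with c1 c2 ne IH show ?case unfolding Q'' by (simp add: PQ)
qed

lemma form_hden_hnum:
  assumes "form e P" "form e Q"
  shows "form e (hden P Q)" "form e (hnum P Q)"
  unfolding hden_def hnum_def using assms by (auto intro: form_intros)

lemma form_coupled:
  "form (fib (Suc n)) (coupled_num n) \<and> form (fib (Suc n)) (coupled_den n) \<and>
   form (fib (Suc (Suc n))) (coupled_num (Suc n)) \<and> form (fib (Suc (Suc n))) (coupled_den (Suc n))"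
proof (induction n)
  case 0
  show ?case using form_X form_W by simp
next
  case (Suc n)
  note h = form_hden_hnum[of "fib (Suc n)" "coupled_num n" "coupled_den n"]
  have *: "form (fib (Suc (Suc (Suc n)))) (A * B)"
    if "form (fib (Suc (Suc n))) A" "form (fib (Suc n)) B" for A B
    using form_mult[OF that] by simp
  have "form (fib (Suc (Suc (Suc n)))) (coupled_num (Suc (Suc n)))"
    unfolding coupled_num.simps using Suc.IH h by (intro form_add * form_const3_mult) auto
  moreover have "form (fib (Suc (Suc (Suc n)))) (coupled_den (Suc (Suc n)))"
    unfolding coupled_den.simps using Suc.IH h by (intro *) auto
  ultimately show ?case using Suc.IH by simp
qed

text \<open>\<open>Q\<^sub>n\<close> divides \<open>Q\<^sub>n\<^sub>+\<^sub>1\<close>, so the common denominator is \<open>Q\<^sub>n\<^sub>+\<^sub>1\<close>.\<close>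

theorem iter_degree_fib:
  assumes "\<alpha>1 \<noteq> 0" "n \<ge> 1"
  shows "iter_degree F n = fib (n + 2)"
proof -
  note c = coupled_coprime[OF assms(1)]
  obtain m where n: "n = Suc m" using assms(2) by (cases n) auto
  have orbit: "fraction_orbit coupled_num coupled_den"
    unfolding fraction_orbit_def using c by (simp add: algebra_simps)
  have "iter_degree F n = fib (Suc n) + 0 + fib n"
  proof (rule iter_degree_fraction_orbit[OF orbit])
    show "coupled_den n = coupled_den n * 1"
      "coupled_den (Suc n) = coupled_den n * hden (coupled_num m) (coupled_den m)"
      by (simp_all add: n)
    show "form 0 1" using form_const3[of 1] by simp
    show "form (fib n) (hden (coupled_num m) (coupled_den m))"
      using form_hden_hnum form_coupled by (simp add: n)
    show "form (fib (Suc n)) (coupled_den n)" "form (fib (Suc n) + 0) (coupled_num n)"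
      "form (fib (Suc n) + fib n) (coupled_num (Suc n))"
      using form_coupled[of n] by simp_all
  qed (use c[of n] in \<open>simp_all add: coprime_commute\<close>)
  then show ?thesis by simp
qed

end

section \<open>Lucas sequences and powers of Moebius maps\<close>

text \<open>If \<open>N\<close> is a \<open>2 \<times> 2\<close> matrix with trace \<open>t\<close> and determinant \<open>D\<close>, then Cayley-Hamilton
  gives \<open>N\<^sup>n = U\<^sub>n N + (U\<^sub>n\<^sub>+\<^sub>1 - t U\<^sub>n) I\<close> with \<open>U = lucas t D\<close>.\<close>

fun lucas :: "complex \<Rightarrow> complex \<Rightarrow> nat \<Rightarrow> complex" where
  "lucas t D 0 = 0"
| "lucas t D (Suc 0) = 1"
| "lucas t D (Suc (Suc n)) = t * lucas t D (Suc n) - D * lucas t D n"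

text \<open>The left hand side is the determinant of \<open>N\<^sup>n\<close>.\<close>

lemma lucas_norm:
  "lucas t D (Suc n) ^ 2 - t * lucas t D (Suc n) * lucas t D n + D * lucas t D n ^ 2 = D ^ n"
proof (induction n)
  case (Suc n)
  have "lucas t D (Suc (Suc n)) ^ 2 - t * lucas t D (Suc (Suc n)) * lucas t D (Suc n)
      + D * lucas t D (Suc n) ^ 2
    = D * (lucas t D (Suc n) ^ 2 - t * lucas t D (Suc n) * lucas t D n + D * lucas t D n ^ 2)"
    by (simp add: power2_eq_square algebra_simps)
  then show ?case using Suc.IH by simp
qed simp

lemma lucas_Suc_nonzero:
  assumes "D \<noteq> 0" "lucas t D n = 0"
  shows "lucas t D (Suc n) \<noteq> 0"
proof
  assume "lucas t D (Suc n) = 0"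
  with lucas_norm[of t D n] assms show False by simp
qed

text \<open>Multiplying the matrix by \<open>s\<close> multiplies its trace by \<open>s\<close> and its determinant by \<open>s\<^sup>2\<close>.\<close>

lemma lucas_scale: "s * lucas (s * t) (s ^ 2 * D) n = s ^ n * lucas t D n"
proof (induction t D n rule: lucas.induct)
  case (3 t D n)
  have "s * lucas (s * t) (s ^ 2 * D) (Suc (Suc n))
    = s * t * (s * lucas (s * t) (s ^ 2 * D) (Suc n))
      - s ^ 2 * D * (s * lucas (s * t) (s ^ 2 * D) n)"
    by (simp add: algebra_simps)
  also have "\<dots> = s ^ Suc (Suc n) * lucas t D (Suc (Suc n))"
    unfolding 3 by (simp add: power2_eq_square algebra_simps)
  finally show ?case .
qed simp_all

text \<open>The determinant condition rules out that numerator and denominator of the inner map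
  vanish together.\<close>

lemma moebius_map_comp:
  assumes "A * D - B * C \<noteq> 0" "b \<noteq> 0"
  shows "moebius_map 0 b 1 c (moebius_map A B C D w)
    = moebius_map (b * C) (b * D) (A + c * C) (B + c * D) w"
proof -
  have h: "moebius_map 0 b 1 c (Some z) = (if c + z = 0 then None else Some (b / (c + z)))" for z
    by (simp add: moebius_map_def add.commute)
  show ?thesis
  proof (cases w)
    case None
    show ?thesis
    proof (cases "C = 0")
      case True
      with assms(1) have "A \<noteq> 0" by auto
      with True None show ?thesis by (simp add: moebius_map_def)
    next
      case False
      then have e: "c + A / C = (A + c * C) / C" by (simp add: add_divide_distrib)
      have i: "moebius_map A B C D None = Some (A / C)"
        using False by (simp add: moebius_map_def)
      show ?thesis
        unfolding None i h using False
        by (simp only: moebius_map_def e divide_eq_0_iff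
            divide_divide_eq_right option.case if_False simp_thms)
    qed
  next
    case (Some z)
    have eq: "(A + c * C) * z + (B + c * D) = (A * z + B) + c * (C * z + D)"
      by (simp add: algebra_simps)
    show ?thesis
    proof (cases "C * z + D = 0")
      case True
      have "A * z + B \<noteq> 0"
      proof
        assume "A * z + B = 0"
        have "A * D - B * C = A * (C * z + D) - C * (A * z + B)" by (simp add: algebra_simps)
        with True \<open>A * z + B = 0\<close> assms(1) show False by simp
      qed
      moreover have "b * C * z + b * D = 0"
        unfolding mult.assoc distrib_left[symmetric] True by simp
      ultimately show ?thesis using Some True by (simp add: moebius_map_def eq)
    next
      case False
      have e: "c + (A * z + B) / (C * z + D) = ((A + c * C) * z + (B + c * D)) / (C * z + D)"
        unfolding eq using False by (simp add: add_divide_distrib)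
      have i: "moebius_map A B C D (Some z) = Some ((A * z + B) / (C * z + D))"
        using False by (simp add: moebius_map_def)
      have "b * C * z + b * D = b * (C * z + D)" by (simp add: algebra_simps)
      then show ?thesis
        unfolding Some i h e using False by (simp add: moebius_map_def)
    qed
  qed
qed

text \<open>The matrix of \<open>b / (c + z)\<close> has trace \<open>c\<close> and determinant \<open>- b\<close>.\<close>

lemma moebius_map_funpow:
  assumes "b \<noteq> 0"
  shows "moebius_map 0 b 1 c ^^ n =
    moebius_map (lucas c (- b) (Suc n) - c * lucas c (- b) n) (b * lucas c (- b) n)
      (lucas c (- b) n) (lucas c (- b) (Suc n))"
proof (induction n)
  case 0
  show ?case by (auto simp: moebius_map_def fun_eq_iff split: option.splits)
next
  case (Suc n)
  let ?u = "lucas c (- b) n" and ?v = "lucas c (- b) (Suc n)"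
  have "(?v - c * ?u) * ?v - b * ?u * ?u = (- b) ^ n"
    unfolding lucas_norm[of c "- b" n, symmetric] by (simp add: power2_eq_square algebra_simps)
  then have "(?v - c * ?u) * ?v - b * ?u * ?u \<noteq> 0" using assms by simp
  from moebius_map_comp[OF this assms] show ?case
    unfolding funpow.simps Suc.IH by (simp add: fun_eq_iff algebra_simps)
qed

text \<open>\<open>U\<^sub>n\<close> is the lower left entry of the \<open>n\<close>-th power. If it vanishes, the power is a scalar
  matrix and not only a triangular one: fixing \<open>\<infinity>\<close> already forces the iterate to be the
  identity.\<close>

lemma moebius_map_funpow_eq_id_iff:
  assumes "b \<noteq> 0"
  shows "moebius_map 0 b 1 c ^^ n = id \<longleftrightarrow> lucas c (- b) n = 0"
proof
  assume "moebius_map 0 b 1 c ^^ n = id"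
  then have "(moebius_map 0 b 1 c ^^ n) None = None" by simp
  then show "lucas c (- b) n = 0"
    unfolding moebius_map_funpow[OF assms] by (simp add: moebius_map_def split: if_splits)
next
  assume "lucas c (- b) n = 0"
  with lucas_Suc_nonzero[of "- b" c n] assms show "moebius_map 0 b 1 c ^^ n = id"
    unfolding moebius_map_funpow[OF assms]
    by (auto simp: moebius_map_def fun_eq_iff split: option.splits)
qed

section \<open>The decoupled case: degrees one and two\<close>

context affine_moebius
begin

text \<open>Trace and determinant of the matrix with rows \<open>(\<alpha>0 + \<alpha>2 b1, \<alpha>0 g + \<alpha>2 b0)\<close> and \<open>(1, g)\<close>
  of the Moebius map \<open>\<phi> = \<alpha>0 + \<alpha>2 h\<close>.\<close>

definition tr :: complex where "tr = \<alpha>0 + \<alpha>2 * b1 + g"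
definition dt :: complex where "dt = \<alpha>2 * (b1 * g - b0)"

lemma dt_nonzero: "dt \<noteq> 0"
  using \<alpha>2 nondeg by (simp add: dt_def mult.commute)

text \<open>\<open>pow_num X m / pow_den X m\<close> is \<open>\<phi>\<^sup>m(X / X0)\<close>, with the entries of the \<open>m\<close>-th matrix power
  expressed by the Lucas sequence.\<close>

definition pow_num :: "poly3 \<Rightarrow> nat \<Rightarrow> poly3"
  where "pow_num X m = const3 (lucas tr dt (Suc m) - g * lucas tr dt m) * X
    + const3 ((\<alpha>0 * g + \<alpha>2 * b0) * lucas tr dt m) * X0"

definition pow_den :: "poly3 \<Rightarrow> nat \<Rightarrow> poly3"
  where "pow_den X m = const3 (lucas tr dt m) * X
    + const3 (lucas tr dt (Suc m) - (\<alpha>0 + \<alpha>2 * b1) * lucas tr dt m) * X0"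

text \<open>One application of \<open>\<phi>\<close> to \<open>P / Q\<close> has denominator \<open>hden P Q\<close>; comparing coefficients
  leaves the recurrence of the Lucas sequence.\<close>

lemma pow_den_Suc: "pow_den X (Suc m) = hden (pow_num X m) (pow_den X m)"
proof -
  let ?u = "lucas tr dt m" and ?v = "lucas tr dt (Suc m)"
  have "hden (pow_num X m) (pow_den X m) = const3 (g * ?u + (?v - g * ?u)) * X
      + const3 (g * (?v - (\<alpha>0 + \<alpha>2 * b1) * ?u) + (\<alpha>0 * g + \<alpha>2 * b0) * ?u) * X0"
    unfolding hden_def pow_num_def pow_den_def const3_add[of "_ * _"] const3_mult[of g]
    by (simp add: algebra_simps)
  also have "g * ?u + (?v - g * ?u) = ?v" by simp
  also have "g * (?v - (\<alpha>0 + \<alpha>2 * b1) * ?u) + (\<alpha>0 * g + \<alpha>2 * b0) * ?u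
     = lucas tr dt (Suc (Suc m)) - (\<alpha>0 + \<alpha>2 * b1) * ?v"
    by (simp add: tr_def dt_def algebra_simps)
  finally show ?thesis by (simp add: pow_den_def)
qed

lemma pow_num_Suc: "pow_num X (Suc m) =
    const3 \<alpha>0 * hden (pow_num X m) (pow_den X m) + const3 \<alpha>2 * hnum (pow_num X m) (pow_den X m)"
proof -
  let ?u = "lucas tr dt m" and ?v = "lucas tr dt (Suc m)"
  let ?a = "?v - g * ?u" and ?b = "(\<alpha>0 * g + \<alpha>2 * b0) * ?u" and ?d = "?v - (\<alpha>0 + \<alpha>2 * b1) * ?u"
  have "const3 \<alpha>0 * hden (pow_num X m) (pow_den X m) + const3 \<alpha>2 * hnum (pow_num X m) (pow_den X m)
    = const3 (\<alpha>0 * (g * ?u + ?a) + \<alpha>2 * (b0 * ?u + b1 * ?a)) * X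
      + const3 (\<alpha>0 * (g * ?d + ?b) + \<alpha>2 * (b0 * ?d + b1 * ?b)) * X0"
    unfolding hden_def hnum_def pow_num_def pow_den_def
      const3_add[of "_ * _"] const3_mult[of \<alpha>0] const3_mult[of \<alpha>2] const3_mult[of g]
      const3_mult[of b0] const3_mult[of b1]
    by (simp add: algebra_simps)
  also have "\<alpha>0 * (g * ?u + ?a) + \<alpha>2 * (b0 * ?u + b1 * ?a)
      = lucas tr dt (Suc (Suc m)) - g * ?v"
    by (simp add: tr_def dt_def algebra_simps)
  also have "\<alpha>0 * (g * ?d + ?b) + \<alpha>2 * (b0 * ?d + b1 * ?b) = (\<alpha>0 * g + \<alpha>2 * b0) * ?v"
    by (simp add: algebra_simps)
  finally show ?thesis by (simp add: pow_num_def)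
qed

lemma matrix_det:
  "(lucas tr dt (Suc m) - g * lucas tr dt m) * (lucas tr dt (Suc m) - (\<alpha>0 + \<alpha>2 * b1) * lucas tr dt m)
    - (\<alpha>0 * g + \<alpha>2 * b0) * lucas tr dt m * lucas tr dt m = dt ^ m"
  unfolding lucas_norm[of tr dt m, symmetric]
  by (simp add: tr_def dt_def power2_eq_square algebra_simps)

text \<open>The matrix power is invertible over \<open>\<complex>\<close>, so a common factor of the two combinations of
  \<open>X\<close> and \<open>X0\<close> divides \<open>X\<close> and \<open>X0\<close>.\<close>

lemma pow_coprime:
  assumes "coprime X X0"
  shows "pow_den X m \<noteq> 0" "coprime (pow_num X m) (pow_den X m)"
proof -
  let ?a = "lucas tr dt (Suc m) - g * lucas tr dt m"
    and ?b = "(\<alpha>0 * g + \<alpha>2 * b0) * lucas tr dt m"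
    and ?c = "lucas tr dt m"
    and ?d = "lucas tr dt (Suc m) - (\<alpha>0 + \<alpha>2 * b1) * lucas tr dt m"
  have det: "?a * ?d - ?b * ?c = dt ^ m" by (rule matrix_det)
  have ne: "dt ^ m \<noteq> 0" using dt_nonzero by simp
  show nz: "pow_den X m \<noteq> 0"
  proof
    assume 0: "pow_den X m = 0"
    show False
    proof (cases "?c = 0")
      case True
      then have "?d = 0" using 0 X_nonzero by (simp add: pow_den_def)
      with True det ne show False by simp
    next
      case False
      have "const3 ?c * X = X0 * (- const3 ?d)"
        using 0 by (simp add: pow_den_def eq_neg_iff_add_eq_0 mult.commute)
      then have "X0 dvd const3 ?c * X" by (metis dvd_triv_left)
      then have "X0 dvd X" by (simp only: dvd_const3_mult_iff[OF False])
      with assms have "is_unit X0" by (meson coprime_common_divisor dvd_refl)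
      with X0_not_unit show False ..
    qed
  qed
  have X: "const3 ?d * pow_num X m - const3 ?b * pow_den X m = const3 (dt ^ m) * X"
    and X0: "const3 ?a * pow_den X m - const3 ?c * pow_num X m = const3 (dt ^ m) * X0"
    unfolding det[symmetric] const3_diff[of "_ * _"] const3_mult[of ?a] const3_mult[of ?b]
      pow_num_def pow_den_def
    by (simp_all only: algebra_simps)
  have "coprime (pow_den X m) (pow_num X m)"
  proof (rule coprime_primeI[OF nz])
    fix r assume r: "prime r" "r dvd pow_den X m" "r dvd pow_num X m"
    have "r dvd const3 (dt ^ m) * X" "r dvd const3 (dt ^ m) * X0"
      unfolding X[symmetric] X0[symmetric] using r by simp_all
    then have "r dvd X" "r dvd X0" by (simp_all only: dvd_const3_mult_iff[OF ne])
    with r(1) assms show False using prime_not_dvd_coprime by blast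
  qed
  then show "coprime (pow_num X m) (pow_den X m)" by (simp add: coprime_commute)
qed

lemma form_pow: "form 1 X \<Longrightarrow> form 1 (pow_num X m)" "form 1 X \<Longrightarrow> form 1 (pow_den X m)"
  unfolding pow_num_def pow_den_def by (intro form_intros form_X, assumption)+

text \<open>Even terms come from \<open>x\<^sub>0 = X1 / X0\<close>, odd terms from \<open>x\<^sub>1 = W / X0\<close>.\<close>

definition decoupled_num :: "nat \<Rightarrow> poly3"
  where "decoupled_num n = pow_num (if even n then X1 else W) (n div 2)"
definition decoupled_den :: "nat \<Rightarrow> poly3"
  where "decoupled_den n = pow_den (if even n then X1 else W) (n div 2)"

lemma decoupled_coprime: "decoupled_den n \<noteq> 0" "coprime (decoupled_num n) (decoupled_den n)"
  using pow_coprime coprime_X1_X0 coprime_W_X0 by (simp_all add: decoupled_num_def decoupled_den_def)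

lemma form_decoupled: "form 1 (decoupled_num n)" "form 1 (decoupled_den n)"
  using form_pow form_X form_W by (simp_all add: decoupled_num_def decoupled_den_def)

lemma fraction_orbit_decoupled:
  assumes "\<alpha>1 = 0"
  shows "fraction_orbit decoupled_num decoupled_den"
proof -
  have Q: "decoupled_den (Suc (Suc n)) = hden (decoupled_num n) (decoupled_den n)"
    and P: "decoupled_num (Suc (Suc n)) =
      const3 \<alpha>0 * hden (decoupled_num n) (decoupled_den n)
        + const3 \<alpha>2 * hnum (decoupled_num n) (decoupled_den n)" for n
    by (simp_all add: decoupled_num_def decoupled_den_def pow_den_Suc pow_num_Suc)
  have "hden (decoupled_num n) (decoupled_den n) \<noteq> 0" for n
    unfolding Q[symmetric] by (rule decoupled_coprime)
  moreover have "decoupled_num 0 = X1" "decoupled_den 0 = X0"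
    "decoupled_num (Suc 0) = W" "decoupled_den (Suc 0) = X0"
    by (simp_all add: decoupled_num_def decoupled_den_def pow_num_def pow_den_def)
  ultimately show ?thesis
    unfolding fraction_orbit_def P Q using assms decoupled_coprime(1) by (simp add: algebra_simps)
qed

lemma pow_den_X1: "pow_den X1 m = const3 (lucas tr dt (Suc m) - (\<alpha>0 + \<alpha>2 * b1) * lucas tr dt m) * X0
    + const3 (lucas tr dt m) * X1"
  by (simp add: pow_den_def add.commute)

lemma pow_den_W: "pow_den W m =
    const3 (lucas tr dt m * \<alpha>0 + (lucas tr dt (Suc m) - (\<alpha>0 + \<alpha>2 * b1) * lucas tr dt m)) * X0
    + const3 (lucas tr dt m * \<alpha>1) * X1 + const3 (lucas tr dt m * \<alpha>2) * X2"
  unfolding pow_den_def W_def const3_add[of "_ * _"] const3_mult[of _ \<alpha>0] const3_mult[of _ \<alpha>1]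
    const3_mult[of _ \<alpha>2]
  by (simp only: algebra_simps)

lemma coprime_pow_den_X1_W:
  assumes "lucas tr dt m \<noteq> 0"
  shows "coprime (pow_den X1 n) (pow_den W m)"
proof (rule coprime_primeI[OF pow_coprime(1)[OF coprime_X1_X0]])
  fix r assume r: "prime r" "r dvd pow_den X1 n" "r dvd pow_den W m"
  show False
  proof (rule no_prime_dvd_linear_forms[OF r(1) r(2)[unfolded pow_den_X1] _ r(3)[unfolded pow_den_W]])
    show "lucas tr dt (Suc n) - (\<alpha>0 + \<alpha>2 * b1) * lucas tr dt n \<noteq> 0 \<or> lucas tr dt n \<noteq> 0"
      using lucas_Suc_nonzero[OF dt_nonzero, of tr n] by auto
  qed (use assms \<alpha>2 in simp)
qed

lemma coprime_X0_pow_den_X1: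
  assumes "lucas tr dt m \<noteq> 0"
  shows "coprime X0 (pow_den X1 m)"
proof (rule coprime_primeI[OF X_nonzero(1)])
  fix r assume r: "prime r" "r dvd X0" "r dvd pow_den X1 m"
  then have "r dvd const3 (lucas tr dt m) * X1"
    unfolding pow_den_X1 by (simp add: dvd_add_right_iff)
  then have "r dvd X1" by (simp only: dvd_const3_mult_iff[OF assms])
  with r show False using no_prime_dvd_X0_X1 by blast
qed

text \<open>If the Lucas number vanishes, \<open>\<phi>\<^sup>m\<close> is affine and both denominators are multiples of
  \<open>X0\<close>. Otherwise one of them involves \<open>X1\<close> but not \<open>X2\<close> and the other one involves \<open>X2\<close>, so
  they are coprime.\<close>

theorem iter_degree_even:
  assumes "\<alpha>1 = 0"
  shows "iter_degree F (2 * m) = (if lucas tr dt m = 0 then 1 else 2)"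
proof (cases "lucas tr dt m = 0")
  case True
  have v: "lucas tr dt (Suc m) \<noteq> 0" by (rule lucas_Suc_nonzero[OF dt_nonzero True])
  have "iter_degree F (2 * m) = 1 + 0 + 0"
  proof (rule iter_degree_fraction_orbit[OF fraction_orbit_decoupled[OF assms]])
    show "decoupled_den (2 * m) = X0 * const3 (lucas tr dt (Suc m))"
      "decoupled_den (Suc (2 * m)) = X0 * const3 (lucas tr dt (Suc m))"
      using True by (simp_all add: decoupled_den_def pow_den_def mult.commute)
    show "coprime (const3 (lucas tr dt (Suc m))) (const3 (lucas tr dt (Suc m)))"
      using dvd_const3_mult_iff[OF v, of "const3 (lucas tr dt (Suc m))" 1]
      by (intro is_unit_left_imp_coprime) simp
  qed (use form_const3 form_X decoupled_coprime form_decoupled in simp_all)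
  then show ?thesis using True by simp
next
  case False
  have "iter_degree F (2 * m) = 0 + 1 + 1"
  proof (rule iter_degree_fraction_orbit[OF fraction_orbit_decoupled[OF assms]])
    show "decoupled_den (2 * m) = 1 * decoupled_den (2 * m)"
      "decoupled_den (Suc (2 * m)) = 1 * decoupled_den (Suc (2 * m))" by simp_all
    show "coprime (decoupled_den (2 * m)) (decoupled_den (Suc (2 * m)))"
      using coprime_pow_den_X1_W[OF False] by (simp add: decoupled_den_def)
    show "form 0 1" using form_const3[of 1] by simp
  qed (use decoupled_coprime form_decoupled in simp_all)
  then show ?thesis using False by simp
qed

text \<open>The denominators of \<open>\<phi>\<^sup>m(x\<^sub>1)\<close> and \<open>\<phi>\<^sup>m\<^sup>+\<^sup>1(x\<^sub>0)\<close> have no common factor, since consecutive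
  Lucas numbers do not both vanish.\<close>

theorem iter_degree_odd:
  assumes "\<alpha>1 = 0"
  shows "iter_degree F (Suc (2 * m)) = 2"
proof -
  have "iter_degree F (Suc (2 * m)) = 0 + 1 + 1"
  proof (rule iter_degree_fraction_orbit[OF fraction_orbit_decoupled[OF assms]])
    let ?n = "Suc (2 * m)"
    show "decoupled_den ?n = 1 * decoupled_den ?n"
      "decoupled_den (Suc ?n) = 1 * decoupled_den (Suc ?n)" by simp_all
    show "coprime (decoupled_den ?n) (decoupled_den (Suc ?n))"
    proof (cases "lucas tr dt m = 0")
      case True
      have v: "lucas tr dt (Suc m) \<noteq> 0" by (rule lucas_Suc_nonzero[OF dt_nonzero True])
      have W: "pow_den W m = const3 (lucas tr dt (Suc m)) * X0"
        using True by (simp add: pow_den_def)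
      have "coprime (pow_den W m) (pow_den X1 (Suc m))"
      proof (rule coprime_primeI[OF pow_coprime(1)[OF coprime_W_X0]])
        fix r assume r: "prime r" "r dvd pow_den W m" "r dvd pow_den X1 (Suc m)"
        then have "r dvd X0" by (simp only: W dvd_const3_mult_iff[OF v])
        with r coprime_X0_pow_den_X1[OF v] show False using prime_not_dvd_coprime by blast
      qed
      then show ?thesis by (simp add: decoupled_den_def)
    next
      case False
      then show ?thesis using coprime_pow_den_X1_W[OF False]
        by (simp add: decoupled_den_def coprime_commute)
    qed
    show "form 0 1" using form_const3[of 1] by simp
  qed (use decoupled_coprime form_decoupled in simp_all)
  then show ?thesis by simp
qed

end

section \<open>The affine normal form\<close>

lemma normal_form_fract: "(x2, const2 b / (const2 c + x1)) = (to_fract [:0, 1:], moeb_x1 b 0 c)"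
proof -
  have "const2 0 = 0" "const2 1 = 1" by (simp_all add: const2_def flip: one_pCons)
  then show ?thesis using moebius_fract[of 1 b 0 c] by (simp add: x2_def)
qed

lemma normal_form_dom:
  assumes "b \<noteq> 0"
  shows "x \<in> rat_dom (x2, const2 b / (const2 c + x1)) \<longleftrightarrow> fst x \<noteq> - c"
  unfolding normal_form_fract using assms by (subst rat_dom_affine_moeb) auto

lemma normal_form_dom_0: "x \<in> rat_dom (x2, const2 0 / (const2 c + x1))"
  unfolding normal_form_fract using moeb_x1_degenerate[of c 0]
  by (simp add: rat_dom_def numer_denom_to_fract numer_denom_to_fract[of 0, simplified])

lemma normal_form_app:
  assumes "b \<noteq> 0"
  shows "rat_app (x2, const2 b / (const2 c + x1)) x = (snd x, b / (c + fst x))"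
  unfolding normal_form_fract using assms by (subst rat_app_affine_moeb) auto

context affine_moebius
begin

lemma plane_map_dom: "x \<in> rat_dom plane_map \<longleftrightarrow> fst x \<noteq> - g"
  unfolding plane_map_def by (rule rat_dom_affine_moeb[OF nondeg])

lemma plane_map_app: "rat_app plane_map x =
    (\<alpha>0 + \<alpha>1 * fst x + \<alpha>2 * snd x, (b0 + b1 * fst x) / (g + fst x))"
  unfolding plane_map_def by (simp add: rat_app_affine_moeb[OF nondeg])

text \<open>The translation in the first coordinate of \<open>A\<close> is chosen so that the second component of
  the conjugated map vanishes at \<open>\<infinity>\<close>; the second coordinate of \<open>A\<close> must then be the first
  coordinate of \<open>A \<circ> f\<close>.\<close>

lemma affine_conj_normal_form:
  assumes "\<alpha>1 = 0"
  shows "affine_conj plane_map (x2, const2 (- dt) / (const2 tr + x1))"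
proof -
  define A where "A = (\<lambda>(x :: complex, y).
    (1 * x + 0 * y + (- \<alpha>0 - \<alpha>2 * b1), 0 * x + \<alpha>2 * y + (- \<alpha>2 * b1)))"
  have nz: "- dt \<noteq> 0" using dt_nonzero by simp
  have shift: "tr + fst (A x) = g + fst x" for x
    by (simp add: A_def tr_def split: prod.splits)
  show ?thesis
    unfolding affine_conj_def
  proof (intro exI[of _ A] conjI allI ballI)
    show "affine_auto A"
      unfolding affine_auto_def A_def
      by (rule exI[of _ 1], rule exI[of _ 0], rule exI[of _ 0], rule exI[of _ \<alpha>2],
          rule exI[of _ "- \<alpha>0 - \<alpha>2 * b1"], rule exI[of _ "- \<alpha>2 * b1"]) (use \<alpha>2 in simp)
    show "A x \<in> rat_dom (x2, const2 (- dt) / (const2 tr + x1)) \<longleftrightarrow> x \<in> rat_dom plane_map" for x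
      using shift[of x] unfolding normal_form_dom[OF nz] plane_map_dom eq_neg_iff_add_eq_0
      by (simp add: add.commute)
    fix x assume "x \<in> rat_dom plane_map"
    then have x: "g + fst x \<noteq> 0" by (simp add: plane_map_dom eq_neg_iff_add_eq_0 add.commute)
    have "\<alpha>2 * ((b0 + b1 * fst x) / (g + fst x)) - \<alpha>2 * b1
      = (\<alpha>2 * (b0 + b1 * fst x) - \<alpha>2 * b1 * (g + fst x)) / (g + fst x)"
      using x by (simp add: diff_divide_distrib)
    also have "\<alpha>2 * (b0 + b1 * fst x) - \<alpha>2 * b1 * (g + fst x) = - dt"
      by (simp add: dt_def algebra_simps)
    finally have "\<alpha>2 * ((b0 + b1 * fst x) / (g + fst x)) - \<alpha>2 * b1 = - dt / (g + fst x)" .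
    then show "rat_app (x2, const2 (- dt) / (const2 tr + x1)) (A x) = A (rat_app plane_map x)"
      unfolding normal_form_app[OF nz] plane_map_app shift
      by (simp add: A_def assms split: prod.splits)
  qed
qed

text \<open>The domains determine the first row of the conjugating map up to the factor \<open>s\<close>: it
  sends the pole line \<open>x1 = - g\<close> to \<open>x1 = - c\<close>. Comparing the two components of the conjugacy
  relation then fixes the second row and the parameters \<open>b\<close> and \<open>c\<close>.\<close>

lemma affine_conj_normal_form_unique:
  assumes "\<alpha>1 = 0" "affine_conj plane_map (x2, const2 b / (const2 c + x1))"
  shows "\<exists>s. s \<noteq> 0 \<and> c = s * tr \<and> b = - (s ^ 2 * dt)"
proof -
  let ?G = "(x2, const2 b / (const2 c + x1))"
  obtain A p q p' q' u v where det: "p * q' - q * p' \<noteq> 0"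
    and A: "A = (\<lambda>(x, y). (p * x + q * y + u, p' * x + q' * y + v))"
    and dom: "\<And>x. A x \<in> rat_dom ?G \<longleftrightarrow> x \<in> rat_dom plane_map"
    and app: "\<And>x. x \<in> rat_dom plane_map \<Longrightarrow> rat_app ?G (A x) = A (rat_app plane_map x)"
    using assms(2) unfolding affine_conj_def affine_auto_def by blast
  have b: "b \<noteq> 0"
    using dom[of "(- g, 0)"] normal_form_dom_0 plane_map_dom by fastforce
  have dom': "p * x + q * y + u \<noteq> - c \<longleftrightarrow> x \<noteq> - g" for x y
    using dom[of "(x, y)"] unfolding normal_form_dom[OF b] plane_map_dom by (simp add: A)
  have q: "q = 0"
  proof -
    have "p * (- g) + q * 0 + u = - c" "p * (- g) + q * 1 + u = - c" using dom' by blast+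
    then have "p * (- g) + q * 1 + u = p * (- g) + q * 0 + u" by simp
    then show ?thesis by simp
  qed
  have u: "u = p * g - c"
  proof -
    have "p * (- g) + q * 0 + u = - c" using dom' by blast
    then show ?thesis by (simp add: algebra_simps)
  qed
  have p: "p \<noteq> 0" using det q by auto
  \<comment> \<open>With \<open>x1 = z - g\<close> the pole of \<open>h\<close> is at \<open>z = 0\<close>; the points \<open>z = 1, 2\<close> determine all parameters.\<close>
  have 1: "p' * (z - g) + q' * y + v = p * (\<alpha>0 + \<alpha>2 * y) + u"
    and 2: "b / (p * z) = p' * (\<alpha>0 + \<alpha>2 * y) + q' * ((b0 - g * b1 + b1 * z) / z) + v"
    if "z \<noteq> 0" for y z
  proof -
    have "(z - g, y) \<in> rat_dom plane_map" using that by (simp add: plane_map_dom)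
    from app[OF this] have e: "rat_app ?G (A (z - g, y)) = A (rat_app plane_map (z - g, y))" .
    have l: "A (z - g, y) = (p * z - c, p' * (z - g) + q' * y + v)"
      by (simp add: A q u algebra_simps)
    have r: "rat_app plane_map (z - g, y) = (\<alpha>0 + \<alpha>2 * y, (b0 - g * b1 + b1 * z) / z)"
      unfolding plane_map_app by (simp add: assms(1) algebra_simps)
    show "p' * (z - g) + q' * y + v = p * (\<alpha>0 + \<alpha>2 * y) + u"
      and "b / (p * z) = p' * (\<alpha>0 + \<alpha>2 * y) + q' * ((b0 - g * b1 + b1 * z) / z) + v"
      using e unfolding normal_form_app[OF b] l r by (simp_all add: A q)
  qed
  have p': "p' = 0"
  proof -
    have "p' * (1 - g) + v = p' * (2 - g) + v" using 1[of 1 0] 1[of 2 0] by simp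
    then show ?thesis by simp
  qed
  have v: "v = p * \<alpha>0 + u"
    using 1[of 1 0] p' by simp
  have q': "q' = p * \<alpha>2"
    using 1[of 1 1] p' v by (simp add: algebra_simps)
  define K where "K = b0 - g * b1"
  have 3: "b / p = q' * (K + b1) + v"
    using 2[of 1 0] by (simp add: p' K_def)
  have 4: "b / p = q' * (K + b1 * 2) + 2 * v"
  proof -
    have "b / p = 2 * (b / (p * 2))" by simp
    also have "\<dots> = 2 * (q' * ((K + b1 * 2) / 2) + v)"
      using 2[of 2 0] by (simp add: p' K_def)
    also have "\<dots> = q' * (K + b1 * 2) + 2 * v" by (simp add: distrib_left)
    finally show ?thesis .
  qed
  have v': "q' * b1 + v = 0" using 3 4 by (simp add: algebra_simps)
  then have "b / p = q' * K" using 3 by (simp add: algebra_simps)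
  then have "b = p * (q' * K)" using p by (metis nonzero_mult_div_cancel_left times_divide_eq_right)
  then have "b = - (p ^ 2 * dt)"
    by (simp add: q' K_def dt_def power2_eq_square algebra_simps)
  moreover have "c = p * tr"
    using v' by (simp add: v u q' tr_def algebra_simps eq_neg_iff_add_eq_0)
  ultimately show ?thesis using p by blast
qed

lemma normal_form_funpow_eq_id_iff:
  assumes "\<alpha>1 = 0" "affine_conj plane_map (x2, const2 b / (const2 c + x1))"
  shows "moebius_map 0 b 1 c ^^ m = id \<longleftrightarrow> lucas tr dt m = 0"
proof -
  obtain s where s: "s \<noteq> 0" "c = s * tr" "b = - (s ^ 2 * dt)"
    using affine_conj_normal_form_unique[OF assms] by blast
  have "b \<noteq> 0" using s dt_nonzero by simp
  from moebius_map_funpow_eq_id_iff[OF this, where c = c and n = m]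
  have "moebius_map 0 b 1 c ^^ m = id \<longleftrightarrow> lucas (s * tr) (s ^ 2 * dt) m = 0"
    by (simp add: s)
  also have "\<dots> \<longleftrightarrow> lucas tr dt m = 0"
    using lucas_scale[of s tr dt m] s(1) by (metis mult_eq_0_iff power_not_zero)
  finally show ?thesis .
qed

end

section \<open>Periods and limits\<close>

lemma funpow_eq_id_iff_dvd:
  assumes "periodic_map k h"
  shows "h ^^ m = id \<longleftrightarrow> k dvd m"
proof -
  have k: "k \<ge> 1" "h ^^ k = id" and min: "\<And>j. 1 \<le> j \<Longrightarrow> j < k \<Longrightarrow> h ^^ j \<noteq> id"
    using assms by (auto simp: periodic_map_def)
  have "h ^^ m = h ^^ (m mod k)"
    using funpow_mod_eq[where f = h and n = k and m = m] k(2) by (auto simp: fun_eq_iff)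
  moreover have "m mod k < k" using k(1) by simp
  ultimately show ?thesis
    using min[of "m mod k"] by (cases "m mod k = 0") (auto simp: dvd_eq_mod_eq_0)
qed

lemma periodic_seq_dvd:
  assumes "p \<ge> 1" "x \<noteq> y" "\<And>n. d n = (if p dvd n then x else y)"
  shows "periodic_seq p d"
  unfolding periodic_seq_def
proof (intro conjI allI impI notI)
  fix q assume q: "1 \<le> q \<and> q < p" and per: "\<forall>n\<ge>1. d (n + q) = d n"
  then have "d (p + q) = d p" using assms(1) by blast
  then have "p dvd q" using assms(2,3) by (auto split: if_splits)
  with q show False by (auto dest: dvd_imp_le)
qed (use assms in auto)

text \<open>The golden ratio \<open>\<phi>\<close> satisfies \<open>\<phi>\<^sup>2 = \<phi> + 1\<close>, so \<open>\<phi>\<^sup>n \<le> d\<^sub>n \<le> 2 \<phi>\<^sup>n\<close> propagates from the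
  first two terms.\<close>

lemma fibonacci_root_limit:
  fixes d :: "nat \<Rightarrow> nat"
  assumes "d 1 = 2" "d 2 = 3" "\<And>n. n \<ge> 1 \<Longrightarrow> d (n + 2) = d n + d (n + 1)"
  shows "(\<lambda>n. root n (real (d n))) \<longlonglongrightarrow> (1 + sqrt 5) / 2"
proof -
  define \<phi> :: real where "\<phi> = (1 + sqrt 5) / 2"
  have phi: "\<phi> ^ 2 = \<phi> + 1" "\<phi> > 0"
    by (simp_all add: \<phi>_def power2_eq_square field_simps add_pos_pos)
  have "\<phi> \<le> 2" "\<phi> \<ge> 1"
    using real_sqrt_le_mono[of 5 9] by (simp_all add: \<phi>_def)
  have rec: "\<phi> ^ (n + 2) = \<phi> ^ n + \<phi> ^ (n + 1)" for n
    unfolding power_add phi(1) by (simp add: distrib_left)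
  have bounds: "\<phi> ^ n \<le> d n \<and> d n \<le> 2 * \<phi> ^ n
      \<and> \<phi> ^ (n + 1) \<le> d (n + 1) \<and> d (n + 1) \<le> 2 * \<phi> ^ (n + 1)"
    if "n \<ge> 1" for n
    using that
  proof (induction n rule: nat_induct_at_least)
    case base
    show ?case using assms(1,2) \<open>\<phi> \<le> 2\<close> \<open>\<phi> \<ge> 1\<close> phi(1) by (simp add: numeral_2_eq_2 power2_eq_square)
  next
    case (Suc n)
    have "real (d (n + 2)) = d n + d (n + 1)" using assms(3)[OF Suc.hyps] by simp
    then show ?case using Suc.IH rec[of n] by simp
  qed
  have "(\<lambda>n. root n 2 * \<phi>) \<longlonglongrightarrow> 1 * \<phi>"
    by (intro tendsto_intros LIMSEQ_root_const) simp
  then have upper: "(\<lambda>n. root n 2 * \<phi>) \<longlonglongrightarrow> \<phi>" by simp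
  have "(\<lambda>n. root n (real (d n))) \<longlonglongrightarrow> \<phi>"
  proof (rule tendsto_sandwich[OF _ _ tendsto_const upper])
    have "\<phi> \<le> root n (real (d n)) \<and> root n (real (d n)) \<le> root n 2 * \<phi>" if "n \<ge> 1" for n
    proof -
      have n: "n > 0" using that by simp
      have "root n (\<phi> ^ n) \<le> root n (real (d n))" "root n (real (d n)) \<le> root n (2 * \<phi> ^ n)"
        using bounds[OF that] n by (simp_all add: real_root_le_iff)
      then show ?thesis
        using n phi(2) by (simp add: real_root_mult real_root_power_cancel)
    qed
    then show "\<forall>\<^sub>F n in sequentially. \<phi> \<le> root n (real (d n))"
      "\<forall>\<^sub>F n in sequentially. root n (real (d n)) \<le> root n 2 * \<phi>"
      by (auto simp: eventually_sequentially)
  qed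
  then show ?thesis by (simp add: \<phi>_def)
qed

lemma bounded_root_limit:
  fixes d :: "nat \<Rightarrow> nat"
  assumes "\<And>n. 1 \<le> d n \<and> d n \<le> 2"
  shows "(\<lambda>n. root n (real (d n))) \<longlonglongrightarrow> 1"
proof (rule tendsto_sandwich[OF _ _ tendsto_const LIMSEQ_root_const[of 2]])
  show "\<forall>\<^sub>F n in sequentially. 1 \<le> root n (real (d n))"
    using assms by (auto simp: eventually_sequentially intro!: exI[of _ 1])
  show "\<forall>\<^sub>F n in sequentially. root n (real (d n)) \<le> root n 2"
    using assms by (auto simp: eventually_sequentially intro!: exI[of _ 1])
qed simp

section \<open>The degree sequence and the dynamical degree\<close>

theorem theorem12:
  fixes \<alpha>0 \<alpha>1 \<alpha>2 \<beta>0 \<beta>1 \<gamma>0 \<gamma>1 :: complex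
    and f :: rat_map and F :: proj_map and d :: "nat \<Rightarrow> nat"
  assumes "\<gamma>1 \<noteq> 0" and "\<alpha>2 \<noteq> 0"
    and f: "f = (const2 \<alpha>0 + const2 \<alpha>1 * x1 + const2 \<alpha>2 * x2,
                 (const2 \<beta>0 + const2 \<beta>1 * x1) / (const2 \<gamma>0 + const2 \<gamma>1 * x1))"
    and "birational f"
    and F: "F = extension f"
    and d: "\<And>n. d n = iter_degree F n"
  shows
    "(\<alpha>1 \<noteq> 0 \<longrightarrow>
        has_dynamical_degree F ((1 + sqrt 5) / 2) \<and>
        (\<forall>n\<ge>1. d (n + 2) = d n + d (n + 1))) \<and>
     (\<alpha>1 = 0 \<longrightarrow>
        (\<exists>b c. affine_conj f (x2, const2 b / (const2 c + x1))) \<and>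
        has_dynamical_degree F 1 \<and>
        (\<forall>b c. affine_conj f (x2, const2 b / (const2 c + x1)) \<longrightarrow>
           ((\<nexists>k. periodic_map k (moebius_map 0 b 1 c)) \<longrightarrow> (\<forall>n\<ge>1. d n = 2)) \<and>
           (\<forall>k. periodic_map k (moebius_map 0 b 1 c) \<longrightarrow> periodic_seq (2 * k) d)))"
proof -
  define b0 b1 g where "b0 = \<beta>0 / \<gamma>1" "b1 = \<beta>1 / \<gamma>1" "g = \<gamma>0 / \<gamma>1"
  have f': "f = (to_fract [:[:\<alpha>0, \<alpha>1:], [:\<alpha>2:]:], moeb_x1 b0 b1 g)"
    unfolding f affine_fract moebius_fract[OF assms(1)] b0_b1_g_def ..
  interpret M: affine_moebius \<alpha>0 \<alpha>1 \<alpha>2 b0 b1 g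
    using assms(2,4) birational_imp_nondegenerate unfolding f' by unfold_locales auto
  have FM: "F = M.F" and fM: "f = M.plane_map"
    by (simp_all add: F f' M.F_def M.plane_map_def)
  show ?thesis
  proof (intro conjI impI)
    assume a1: "\<alpha>1 \<noteq> 0"
    have dn: "d n = fib (n + 2)" if "n \<ge> 1" for n
      using M.iter_degree_fib[OF a1 that] by (simp add: d FM)
    then show rec: "\<forall>n\<ge>1. d (n + 2) = d n + d (n + 1)" by simp
    have "d 1 = 2" "d 2 = 3" using dn[of 1] dn[of 2] by (simp_all add: numeral_eq_Suc)
    then show "has_dynamical_degree F ((1 + sqrt 5) / 2)"
      using fibonacci_root_limit[of d] rec by (simp add: has_dynamical_degree_def d)
  next
    assume a1: "\<alpha>1 = 0"
    have d_even: "d (2 * m) = (if lucas M.tr M.dt m = 0 then 1 else 2)" for m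
      using M.iter_degree_even[OF a1] by (simp add: d FM)
    have d_odd: "d (Suc (2 * m)) = 2" for m
      using M.iter_degree_odd[OF a1] by (simp add: d FM)
    have dn: "d n = (if even n \<and> lucas M.tr M.dt (n div 2) = 0 then 1 else 2)" for n :: nat
      using d_even[of "n div 2"] d_odd[of "n div 2"] by (cases "even n") auto
    show "\<exists>b c. affine_conj f (x2, const2 b / (const2 c + x1))"
      using M.affine_conj_normal_form[OF a1] fM by blast
    have "1 \<le> d n \<and> d n \<le> 2" for n by (simp add: dn)
    from bounded_root_limit[OF this] show "has_dynamical_degree F 1"
      by (simp add: has_dynamical_degree_def d)
    show "\<forall>b c. affine_conj f (x2, const2 b / (const2 c + x1)) \<longrightarrow>
           ((\<nexists>k. periodic_map k (moebius_map 0 b 1 c)) \<longrightarrow> (\<forall>n\<ge>1. d n = 2)) \<and>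
           (\<forall>k. periodic_map k (moebius_map 0 b 1 c) \<longrightarrow> periodic_seq (2 * k) d)"
    proof (intro allI impI conjI)
      fix b c :: complex and n :: nat
      assume "affine_conj f (x2, const2 b / (const2 c + x1))"
      note id = M.normal_form_funpow_eq_id_iff[OF a1 this[unfolded fM]]
      assume np: "\<nexists>k. periodic_map k (moebius_map 0 b 1 c)" and n: "1 \<le> n"
      have "lucas M.tr M.dt m \<noteq> 0" if "m \<ge> 1" for m
      proof
        assume "lucas M.tr M.dt m = 0"
        then have ex: "1 \<le> m \<and> moebius_map 0 b 1 c ^^ m = id" using that id by simp
        define k where "k = (LEAST m. 1 \<le> m \<and> moebius_map 0 b 1 c ^^ m = id)"
        have "periodic_map k (moebius_map 0 b 1 c)"
          unfolding periodic_map_def k_def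
          using LeastI[of "\<lambda>m. 1 \<le> m \<and> moebius_map 0 b 1 c ^^ m = id", OF ex] not_less_Least by blast
        with np show False by blast
      qed
      then show "d n = 2" using n by (auto simp: dn elim!: evenE)
    next
      fix b c :: complex and k :: nat
      assume "affine_conj f (x2, const2 b / (const2 c + x1))"
      note id = M.normal_form_funpow_eq_id_iff[OF a1 this[unfolded fM]]
      assume k: "periodic_map k (moebius_map 0 b 1 c)"
      then have "2 * k \<ge> 1" by (simp add: periodic_map_def)
      moreover have "d n = (if 2 * k dvd n then 1 else 2)" for n :: nat
      proof (cases "even n")
        case True
        then obtain m where m: "n = 2 * m" by (rule evenE)
        have "lucas M.tr M.dt m = 0 \<longleftrightarrow> k dvd m"
          using id[of m] funpow_eq_id_iff_dvd[OF k, of m] by blast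
        then show ?thesis unfolding m d_even by simp
      next
        case False
        then have "\<not> 2 * k dvd n" by (metis dvd_mult_left)
        with False show ?thesis by (simp add: dn)
      qed
      ultimately show "periodic_seq (2 * k) d" by (intro periodic_seq_dvd[of _ 1 2]) auto
    qed
  qed
qed

end
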